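(* Let $g_\sigma:\mathbb R^n\to\mathbb R\cup\{+\infty\}$ be of class $\mathcal C^2$ with $L$-Lipschitz continuous gradient, $L<1$, and let $\mathcal D_\sigma=I-\nabla g_\sigma$ with $\mathrm{Im}(\mathcal D_\sigma)$ convex. Let $f:\mathbb R^n\to\mathbb R\cup\{+\infty\}$ be a proper closed function and let $h$ be differentiable with $L_h$-Lipschitz continuous gradient. Suppose that $f$, $g_\sigma$ and $h$ are bounded from below. Let $\alpha,\gamma$ satisfy, with $L_{f_1}:=\frac{L}{\gamma(1-L)}$ and $l:=\frac{L}{\gamma(L+1)}$, $$0<\gamma<\frac1{L_{f_1}+L_h},\qquad 0\le\alpha<\frac{1-\gamma l-2\gamma L_h}{2+\gamma L_h}-\gamma^2L_{f_1}^2 .$$ Let $\{(\mathbf y^k,\mathbf z^k,\mathbf x^k)\}_{k\ge1}$ be generated by the nonsmooth extrapolated PnP-DYS iteration: given $\mathbf x^0$ and $\mathbf x^{-1}=\mathbf x^0$, for $k=0,1,2,\dots$, $$\mathbf w^k=\mathbf x^k+\alpha(\mathbf x^k-\mathbf x^{k-1}),\quad \mathbf y^{k+1}=\mathcal D_\sigma(\mathbf w^k),\quad \mathbf z^{k+1}\in\mathrm{Prox}_{\gamma f}(2\mathbf y^{k+1}-\gamma\nabla h(\mathbf y^{k+1})-\mathbf w^k),\quad \mathbf x^{k+1}=\mathbf w^k+(\mathbf z^{k+1}-\mathbf y^{k+1}),$$ and assume this sequence is bounded. Then: (i) the sequence $\{\widehat\Theta_{\alpha,\gamma}(\mathbf y^k,\mathbf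 z^k,\mathbf x^k,\mathbf x^{k-1},\mathbf x^{k-2})\}_{k\ge1}$ is nonincreasing and converges; (ii) the sequences $\{\mathbf x^k-\mathbf x^{k-1}\}$, $\{\mathbf y^k-\mathbf y^{k-1}\}$ and $\{\mathbf y^k-\mathbf z^k\}$ vanish (converge to $0$), with rates $\min_{1\le k\le K}\|\mathbf x^k-\mathbf x^{k-1}\|=\mathcal O(1/\sqrt K)$, $\min_{2\le k\le K}\|\mathbf y^k-\mathbf y^{k-1}\|=\mathcal O(1/\sqrt K)$ and $\min_{1\le k\le K}\|\mathbf y^k-\mathbf z^k\|=\mathcal O(1/\sqrt K)$; (iii) any cluster point $\mathbf u^*=(\mathbf y^*,\mathbf z^*,\mathbf x^*,\mathbf x^*,\mathbf x^* )$ of the sequence $\mathbf u^k=(\mathbf y^k,\mathbf z^k,\mathbf x^k,\mathbf x^{k-1},\mathbf x^{k-2})$, $k\ge1$, is a critical point of the problem $\min F_{\gamma,\sigma}$, i.e., $0\in\partial F_{\gamma,\sigma}(\mathbf y^* )$; (iv) if $h$ is twice continuously differentiable with bounded Hessian, i.e., there exists $M>0$ such that $\|\nabla^2h(\mathbf y)\|\le M$ for all $\mathbf y\in\mathbb R^n$, and $F_{\gamma,\sigma}$ is a KL function, then the whole sequence $\{\mathbf u^k\}_{k\ge1}$ is convergent.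
   Context: For $\gamma>0$, $\mathrm{Prox}_{\gamma f}(\mathbf x)=\arg\min_{\mathbf y\in\mathbb R^n}\{f(\mathbf y)+\frac1{2\gamma}\|\mathbf y-\mathbf x\|^2\}$ (possibly set-valued, in which case any element may be chosen). The function $\phi_\sigma$ is defined by $\phi_\sigma(\mathbf x)=g_\sigma(\mathcal D_\sigma^{-1}(\mathbf x))-\frac12\|\mathcal D_\sigma^{-1}(\mathbf x)-\mathbf x\|^2$ if $\mathbf x\in\mathrm{Im}(\mathcal D_\sigma)$ and $\phi_\sigma(\mathbf x)=+\infty$ otherwise ($\mathcal D_\sigma$ is injective since $L<1$). It is known that $\mathcal D_\sigma(\mathbf x)=\mathrm{Prox}_{\phi_\sigma}(\mathbf x)$, that $\phi_\sigma$ is $\frac{L}{L+1}$-weakly convex, and that $\nabla\phi_\sigma$ is $\frac{L}{1-L}$-Lipschitz on $\mathrm{Im}(\mathcal D_\sigma)$. The objective is $F_{\gamma,\sigma}(\mathbf x)=f(\mathbf x)+\frac1\gamma\phi_\sigma(\mathbf x)+h(\mathbf x)$ on $\mathbb R^n$. Define $$\widehat{\mathcal H}_\gamma(\mathbf y,\mathbf z,\mathbf x)=\tfrac1\gamma\phi_\sigma(\mathbf y)+f(\mathbf z)+h(\mathbf y)+\tfrac1{2\gamma}\|\mathbf y-\mathbf x-\gamma\nabla h(\mathbf y)\|^2-\tfrac1{2\gamma}\|\mathbf z-\mathbf x-\gamma\nabla h(\mathbf y)\|^2,$$ $$\widehat\Theta_{\alpha,\gamma}(\mathbf y,\mathbf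 z,\mathbf x,\mathbf x_1,\mathbf x_2)=\widehat{\mathcal H}_\gamma(\mathbf y,\mathbf z,\mathbf x)+\tfrac{\alpha^2}{2\gamma}\|\mathbf x_1-\mathbf x_2\|^2.$$ Limiting subdifferential: $\widehat\partial F(\mathbf x)$ (for $\mathbf x\in\mathrm{dom} F$) is the set of $\mathbf u$ with $\liminf_{\mathbf y\ne\mathbf x,\mathbf y\to\mathbf x}\frac{F(\mathbf y)-F(\mathbf x)-\langle\mathbf u,\mathbf y-\mathbf x\rangle}{\|\mathbf y-\mathbf x\|}\ge0$ (empty if $\mathbf x\notin\mathrm{dom} F$), and $\partial F(\mathbf x)=\{\mathbf u:\exists\,\mathbf x^k\to\mathbf x,\ F(\mathbf x^k)\to F(\mathbf x),\ \mathbf u^k\in\widehat\partial F(\mathbf x^k),\ \mathbf u^k\to\mathbf u\}$. $\mathrm{dist}(\mathbf x,S)=\inf_{\mathbf y\in S}\|\mathbf y-\mathbf x\|$, equal to $\infty$ if $S=\emptyset$. KL function: a proper lower semicontinuous $F:\mathbb R^n\to(-\infty,+\infty]$ has the KL property at $\mathbf x^*\in\mathrm{dom}(\partial F)$ if there exist $\eta\in(0,+\infty]$, a neighborhood $U$ of $\mathbf x^*$, and a continuous concave $\varphi:[0,\eta)\to\mathbb R_+$ with $\varphi(0)=0$, $\varphi$ continuously differentiable on $(0,\eta)$ with $\varphi'>0$, such that $\varphi'(F(\mathbf x)-F(\mathbf x^* ))\,\mathrm{dist}(0,\partial F(\mathbf x))\ge1$ for all $\mathbf x\in U$ with $F(\mathbf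 x^* )<F(\mathbf x)<F(\mathbf x^* )+\eta$. $F$ is a KL function if it has the KL property at each point of $\mathrm{dom}(\partial F)$. *)

theory Defs
  imports "HOL-Analysis.Analysis" "HOL-Library.Landau_Symbols"
begin

text \<open>
  The space \<open>\<real>\<^sup>n\<close> is an arbitrary type of class \<open>euclidean_space\<close>.  Functions with values
  in \<open>\<real> \<union> {+\<infinity>}\<close> have type \<open>'a \<Rightarrow> ereal\<close>.
\<close>

section \<open>Gradients and Hessians\<close>

definition grad :: "('a::euclidean_space \<Rightarrow> real) \<Rightarrow> 'a \<Rightarrow> 'a" where
  "grad f x = (THE d. GDERIV f x :> d)"

text \<open>Meaningful only where \<open>grad f\<close> is differentiable; its norm is the operator norm.\<close>

definition hessian :: "('a::euclidean_space \<Rightarrow> real) \<Rightarrow> 'a \<Rightarrow> 'a \<Rightarrow>\<^sub>L 'a" where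
  "hessian f x = Blinfun (frechet_derivative (grad f) (at x))"

definition C2 :: "('a::euclidean_space \<Rightarrow> real) \<Rightarrow> bool" where
  "C2 f \<longleftrightarrow> (\<forall>x. f differentiable (at x)) \<and> (\<forall>x. grad f differentiable (at x)) \<and>
     continuous_on UNIV (hessian f)"

section \<open>Extended-real-valued functions\<close>

definition effdom :: "('a \<Rightarrow> ereal) \<Rightarrow> 'a set" where
  "effdom F = {x. F x < \<infinity>}"

definition proper_fun :: "('a \<Rightarrow> ereal) \<Rightarrow> bool" where
  "proper_fun F \<longleftrightarrow> (\<forall>x. F x \<noteq> -\<infinity>) \<and> effdom F \<noteq> {}"

text \<open>A \<^emph>\<open>closed\<close> function is a lower semicontinuous one.\<close>

definition lsc :: "('a::topological_space \<Rightarrow> ereal) \<Rightarrow> bool" where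
  "lsc F \<longleftrightarrow> (\<forall>x. F x \<le> Liminf (at x) F)"

definition prox :: "real \<Rightarrow> ('a::euclidean_space \<Rightarrow> ereal) \<Rightarrow> 'a \<Rightarrow> 'a set" where
  "prox \<gamma> f x =
     {y. is_arg_min (\<lambda>y. f y + ereal (1 / (2 * \<gamma>) * (norm (y - x))\<^sup>2)) (\<lambda>_. True) y}"

definition frechet_subdiff :: "('a::euclidean_space \<Rightarrow> ereal) \<Rightarrow> 'a \<Rightarrow> 'a set" where
  "frechet_subdiff F x =
     {u. x \<in> effdom F \<and>
         0 \<le> Liminf (at x) (\<lambda>y. (F y - F x - ereal (u \<bullet> (y - x))) / ereal (norm (y - x)))}"

definition limiting_subdiff :: "('a::euclidean_space \<Rightarrow> ereal) \<Rightarrow> 'a \<Rightarrow> 'a set" where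
  "limiting_subdiff F x =
     {u. \<exists>X U. X \<longlonglongrightarrow> x \<and> (\<lambda>k. F (X k)) \<longlonglongrightarrow> F x \<and>
           (\<forall>k. U k \<in> frechet_subdiff F (X k)) \<and> U \<longlonglongrightarrow> u}"

text \<open>In contrast to the library's \<open>infdist\<close>, the distance to the empty set is \<open>\<infinity>\<close>.\<close>

definition edist_set :: "'a::euclidean_space \<Rightarrow> 'a set \<Rightarrow> ereal" where
  "edist_set x S = (INF y\<in>S. ereal (norm (y - x)))"

section \<open>The Kurdyka--Lojasiewicz property\<close>

definition KL_at :: "('a::euclidean_space \<Rightarrow> ereal) \<Rightarrow> 'a \<Rightarrow> bool" where
  "KL_at F a \<longleftrightarrow>
     (\<exists>(\<eta>::ereal) U (\<phi>::real \<Rightarrow> real) \<phi>'.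
        0 < \<eta> \<and> open U \<and> a \<in> U \<and>
        continuous_on {t. 0 \<le> t \<and> ereal t < \<eta>} \<phi> \<and>
        concave_on {t. 0 \<le> t \<and> ereal t < \<eta>} \<phi> \<and>
        (\<forall>t. 0 \<le> t \<and> ereal t < \<eta> \<longrightarrow> 0 \<le> \<phi> t) \<and> \<phi> 0 = 0 \<and>
        (\<forall>t. 0 < t \<and> ereal t < \<eta> \<longrightarrow> (\<phi> has_real_derivative \<phi>' t) (at t) \<and> 0 < \<phi>' t) \<and>
        continuous_on {t. 0 < t \<and> ereal t < \<eta>} \<phi>' \<and>
        (\<forall>x\<in>U. F a < F x \<and> F x < F a + \<eta> \<longrightarrow>
           1 \<le> ereal (\<phi>' (real_of_ereal (F x - F a))) * edist_set 0 (limiting_subdiff F x)))"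

definition KL_function :: "('a::euclidean_space \<Rightarrow> ereal) \<Rightarrow> bool" where
  "KL_function F \<longleftrightarrow> proper_fun F \<and> lsc F \<and> (\<forall>a. limiting_subdiff F a \<noteq> {} \<longrightarrow> KL_at F a)"

section \<open>The plug-and-play objective, merit function and iteration\<close>

text \<open>
  The potential \<open>g\<close> is real-valued: it is of class \<open>C\<^sup>2\<close> on the whole space,
  hence finite everywhere.
\<close>

definition denoiser :: "('a::euclidean_space \<Rightarrow> real) \<Rightarrow> 'a \<Rightarrow> 'a" where
  "denoiser g x = x - grad g x"

definition phi :: "('a::euclidean_space \<Rightarrow> real) \<Rightarrow> 'a \<Rightarrow> ereal" where
  "phi g x =
     (if x \<in> range (denoiser g)
      then ereal (g (inv (denoiser g) x) - 1 / 2 * (norm (inv (denoiser g) x - x))\<^sup>2)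
      else \<infinity>)"

definition objective ::
  "real \<Rightarrow> ('a::euclidean_space \<Rightarrow> ereal) \<Rightarrow> ('a \<Rightarrow> real) \<Rightarrow> ('a \<Rightarrow> real) \<Rightarrow> 'a \<Rightarrow> ereal" where
  "objective \<gamma> f g h x = f x + ereal (1 / \<gamma>) * phi g x + ereal (h x)"

definition merit_H ::
  "real \<Rightarrow> ('a::euclidean_space \<Rightarrow> ereal) \<Rightarrow> ('a \<Rightarrow> real) \<Rightarrow> ('a \<Rightarrow> real) \<Rightarrow> 'a \<Rightarrow> 'a \<Rightarrow> 'a \<Rightarrow> ereal"
where
  "merit_H \<gamma> f g h y z x =
     ereal (1 / \<gamma>) * phi g y + f z + ereal (h y)
     + ereal (1 / (2 * \<gamma>) * (norm (y - x - \<gamma> *\<^sub>R grad h y))\<^sup>2)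
     - ereal (1 / (2 * \<gamma>) * (norm (z - x - \<gamma> *\<^sub>R grad h y))\<^sup>2)"

definition merit_Theta ::
  "real \<Rightarrow> real \<Rightarrow> ('a::euclidean_space \<Rightarrow> ereal) \<Rightarrow> ('a \<Rightarrow> real) \<Rightarrow> ('a \<Rightarrow> real) \<Rightarrow>
   'a \<Rightarrow> 'a \<Rightarrow> 'a \<Rightarrow> 'a \<Rightarrow> 'a \<Rightarrow> ereal"
where
  "merit_Theta \<alpha> \<gamma> f g h y z x x1 x2 =
     merit_H \<gamma> f g h y z x + ereal (\<alpha>\<^sup>2 / (2 * \<gamma>) * (norm (x1 - x2))\<^sup>2)"

text \<open>
  Subtraction on indices is truncated, so \<open>x (0 - 1) = x 0\<close>: this is exactly the initialisation
  \<open>x\<^bsup>-1\<^esup> = x\<^bsup>0\<^esup>\<close>.  Likewise \<open>x (1 - 2) = x 0\<close> is \<open>x\<^bsup>-1\<^esup>\<close> in \<open>iterate\<close> below.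
  The values \<open>y 0\<close> and \<open>z 0\<close> are unconstrained and do not belong to the iteration.
\<close>

definition pnp_dys ::
  "real \<Rightarrow> real \<Rightarrow> ('a::euclidean_space \<Rightarrow> ereal) \<Rightarrow> ('a \<Rightarrow> real) \<Rightarrow> ('a \<Rightarrow> real) \<Rightarrow>
   (nat \<Rightarrow> 'a) \<Rightarrow> (nat \<Rightarrow> 'a) \<Rightarrow> (nat \<Rightarrow> 'a) \<Rightarrow> (nat \<Rightarrow> 'a) \<Rightarrow> bool"
where
  "pnp_dys \<alpha> \<gamma> f g h w y z x \<longleftrightarrow>
     (\<forall>k. w k = x k + \<alpha> *\<^sub>R (x k - x (k - 1)) \<and>
          y (k + 1) = denoiser g (w k) \<and>
          z (k + 1) \<in> prox \<gamma> f (2 *\<^sub>R y (k + 1) - \<gamma> *\<^sub>R grad h (y (k + 1)) - w k) \<and>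
          x (k + 1) = w k + (z (k + 1) - y (k + 1)))"

definition iterate ::
  "(nat \<Rightarrow> 'a) \<Rightarrow> (nat \<Rightarrow> 'a) \<Rightarrow> (nat \<Rightarrow> 'a) \<Rightarrow> nat \<Rightarrow> 'a \<times> 'a \<times> 'a \<times> 'a \<times> 'a"
where
  "iterate y z x k = (y k, z k, x k, x (k - 1), x (k - 2))"

end

theory Submission
  imports Defs
begin

text \<open>
  As \<open>L < 1\<close>, the denoiser is a bijection of the whole space. So \<open>\<phi>\<close> is finite everywhere and
  differentiable, \<open>\<nabla>\<phi> u = D\<^sup>-\<^sup>1 u - u\<close> is Lipschitz, and the objective is \<open>f\<close> plus the smooth function
  \<open>s = \<phi>/\<gamma> + h\<close>.
  With \<open>v\<^sub>k = x\<^sub>k - x\<^sub>k\<^sub>-\<^sub>1\<close>, the gap \<open>y\<^sub>k - z\<^sub>k\<close> is \<open>\<alpha> v\<^sub>k\<^sub>-\<^sub>1 - v\<^sub>k\<close>. Comparing two consecutive steps and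
  completing the square in \<open>v\<^sub>k\<close> shows that the merit function decreases by at least \<open>\<epsilon> \<parallel>v\<^sub>k\<parallel>\<^sup>2\<close>. Hence \<open>\<parallel>v\<^sub>k\<parallel>\<^sup>2\<close> is
  summable, and all other increments are bounded by \<open>v\<^sub>k\<close> and \<open>v\<^sub>k\<^sub>-\<^sub>1\<close>.
  The optimality condition at \<open>z\<^sub>k\<close> yields a subgradient of the objective of norm at most a multiple of
  \<open>\<parallel>y\<^sub>k - z\<^sub>k\<parallel>\<close>, and the objective at \<open>z\<^sub>k\<close> differs from the merit function by terms quadratic in \<open>v\<^sub>k\<close> and
  \<open>v\<^sub>k\<^sub>-\<^sub>1\<close>. This suffices to transfer the KL inequality of the objective to the merit values, at the price
  of adding a square root to the desingularising function.
\<close>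

section \<open>Gradients, and quadratic bounds from a Lipschitz gradient\<close>

text \<open>The Riesz representative of the derivative is assembled from its values on
  \<open>Basis\<close>; uniqueness makes the \<open>THE\<close> in \<open>grad\<close> well
  defined.\<close>

lemma differentiable_imp_GDERIV_grad:
  fixes f :: "'a::euclidean_space \<Rightarrow> real"
  assumes "f differentiable (at x)"
  shows "GDERIV f x :> grad f x"
proof -
  obtain f' where f': "(f has_derivative f') (at x)"
    using assms by (auto simp: differentiable_def)
  interpret linear f'
    using f' by (rule has_derivative_linear)
  let ?d = "\<Sum>b\<in>Basis. f' b *\<^sub>R b"
  have rep: "f' v = v \<bullet> ?d" for v
  proof -
    have "f' v = f' (\<Sum>b\<in>Basis. (v \<bullet> b) *\<^sub>R b)"
      by (simp add: euclidean_representation)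
    also have "\<dots> = (\<Sum>b\<in>Basis. (v \<bullet> b) * f' b)"
      by (simp add: sum scale)
    also have "\<dots> = v \<bullet> ?d"
      unfolding inner_sum_right inner_scaleR_right by (simp add: mult.commute)
    finally show ?thesis .
  qed
  have d: "GDERIV f x :> ?d"
    using f' unfolding gderiv_def rep[symmetric] .
  have "grad f x = ?d"
    unfolding grad_def
  proof (rule the_equality)
    show "GDERIV f x :> ?d" by (rule d)
    show "d' = ?d" if "GDERIV f x :> d'" for d'
      using fun_cong[OF has_derivative_unique[OF that[unfolded gderiv_def] d[unfolded gderiv_def]]]
      by (rule vector_eq_ldot[THEN iffD1, OF allI])
  qed
  with d show ?thesis
    by (simp only:)
qed

text \<open>\<open>u\<close> is the error of the quadratic model along the segment from
  \<open>x\<close> to \<open>y\<close>. By Cauchy-Schwarz and the Lipschitz bound its derivative is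
  nonpositive, so \<open>u 1 \<le> u 0\<close>.\<close>

lemma lipschitz_grad_upper_bound:
  fixes f :: "'a::euclidean_space \<Rightarrow> real"
  assumes deriv: "\<And>x. GDERIV f x :> G x" and lip: "L-lipschitz_on UNIV G"
  shows "f y \<le> f x + G x \<bullet> (y - x) + L / 2 * (norm (y - x))\<^sup>2"
proof -
  define d where "d = y - x"
  define u where "u t = f (x + t *\<^sub>R d) - t * (G x \<bullet> d) - L / 2 * t\<^sup>2 * (norm d)\<^sup>2" for t
  define u' where "u' t = d \<bullet> G (x + t *\<^sub>R d) - G x \<bullet> d - L * t * (norm d)\<^sup>2" for t
  have "(u has_real_derivative u' t) (at t)" for t
  proof -
    have "((\<lambda>t. x + t *\<^sub>R d) has_derivative (\<lambda>s. s *\<^sub>R d)) (at t)"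
      by (auto intro!: derivative_eq_intros)
    from has_derivative_compose[OF this deriv[unfolded gderiv_def]]
    have "((\<lambda>t. f (x + t *\<^sub>R d)) has_real_derivative (d \<bullet> G (x + t *\<^sub>R d))) (at t)"
      by (simp add: has_field_derivative_def mult_commute_abs)
    then show ?thesis
      unfolding u_def u'_def by (auto intro!: derivative_eq_intros)
  qed
  moreover have "u' t \<le> 0" if "0 \<le> t" for t
  proof -
    have "d \<bullet> (G (x + t *\<^sub>R d) - G x) \<le> norm d * norm (G (x + t *\<^sub>R d) - G x)"
      by (rule norm_cauchy_schwarz)
    also have "\<dots> \<le> norm d * (L * norm (t *\<^sub>R d))"
      using lipschitz_on_normD[OF lip, of "x + t *\<^sub>R d" x] by (intro mult_left_mono) auto
    finally show ?thesis
      using that by (simp add: u'_def inner_diff_right inner_commute power2_eq_square algebra_simps)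
  qed
  ultimately have "u 1 \<le> u 0"
    by (intro DERIV_nonpos_imp_nonincreasing[of 0 1 u]) auto
  then show ?thesis
    by (simp add: u_def d_def)
qed

lemma lipschitz_grad_lower_bound:
  fixes f :: "'a::euclidean_space \<Rightarrow> real"
  assumes "\<And>x. GDERIV f x :> G x" and "L-lipschitz_on UNIV G"
  shows "f x + G x \<bullet> (y - x) - L / 2 * (norm (y - x))\<^sup>2 \<le> f y"
proof -
  have "- f y \<le> - f x + - G x \<bullet> (y - x) + L / 2 * (norm (y - x))\<^sup>2"
    using lipschitz_grad_upper_bound[of "\<lambda>x. - f x" "\<lambda>x. - G x" L y x] assms
    by (simp add: GDERIV_minus)
  then show ?thesis
    by simp
qed

section \<open>The potential of a contractive denoiser\<close>

locale contractive_denoiser =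
  fixes g :: "'a::euclidean_space \<Rightarrow> real" and L :: real
  assumes differentiable: "\<And>v. g differentiable (at v)"
    and lipschitz: "L-lipschitz_on UNIV (grad g)"
    and contractive: "L < 1"
begin

lemma L_nonneg: "0 \<le> L"
  using lipschitz by (rule lipschitz_on_nonneg)

lemma GDERIV_g: "GDERIV g v :> grad g v"
  using differentiable by (rule differentiable_imp_GDERIV_grad)

lemma norm_grad_diff_le: "norm (grad g v - grad g v') \<le> L * norm (v - v')"
  using lipschitz_on_normD[OF lipschitz] by auto

lemma bij_denoiser: "bij (denoiser g)"
proof (rule bijI)
  show "inj (denoiser g)"
  proof (rule injI)
    fix v v' assume "denoiser g v = denoiser g v'"
    then have "v - v' = grad g v - grad g v'"
      by (simp add: denoiser_def algebra_simps)
    then have "norm (v - v') \<le> L * norm (v - v')"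
      using norm_grad_diff_le[of v v'] by simp
    then have "(1 - L) * norm (v - v') \<le> 0"
      by (simp add: algebra_simps)
    then show "v = v'"
      using contractive by (simp add: mult_le_0_iff)
  qed
  show "surj (denoiser g)"
    unfolding surj_def
  proof
    fix u
    \<comment> \<open>The preimage of \<open>u\<close> is the Banach fixed point of the contraction
      \<open>\<lambda>v. u + grad g v\<close>.\<close>
    have "\<exists>!v. u + grad g v = v"
      using L_nonneg contractive norm_grad_diff_le
      by (intro banach_fix_type[where c = L]) (auto simp: dist_norm)
    then show "\<exists>v. u = denoiser g v"
      by (metis denoiser_def add_diff_cancel_right')
  qed
qed

abbreviation (input) P where "P \<equiv> inv (denoiser g)"

lemma inv_denoiser [simp]: "P (denoiser g v) = v"
  using bij_denoiser by (simp add: bij_is_inj)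

text \<open>Eliminates the gradient at \<open>P u\<close>, so that later identities contain only
  \<open>g\<close>, \<open>P u\<close> and \<open>u\<close>.\<close>

lemma grad_inv_denoiser: "grad g (P u) = P u - u"
proof -
  have "P u - grad g (P u) = u"
    using bij_denoiser by (simp add: bij_is_surj surj_f_inv_f flip: denoiser_def)
  then show ?thesis
    by (metis diff_diff_eq2 add_diff_cancel_left')
qed

lemma norm_inv_denoiser_diff_le: "norm (P u - P u') \<le> norm (u - u') / (1 - L)"
proof -
  have "P u - P u' = (u - u') + (grad g (P u) - grad g (P u'))"
    by (simp add: grad_inv_denoiser)
  then have "norm (P u - P u') \<le> norm (u - u') + L * norm (P u - P u')"
    using norm_triangle_ineq[of "u - u'" "grad g (P u) - grad g (P u')"]
      norm_grad_diff_le[of "P u" "P u'"] by simp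
  then have "norm (P u - P u') * (1 - L) \<le> norm (u - u')"
    by (simp add: algebra_simps)
  then show ?thesis
    using contractive by (simp add: pos_le_divide_eq)
qed

definition \<phi> :: "'a \<Rightarrow> real" where
  "\<phi> u = g (P u) - 1 / 2 * (norm (P u - u))\<^sup>2"

lemma phi_eq: "phi g u = ereal (\<phi> u)"
  using bij_denoiser by (auto simp: phi_def \<phi>_def bij_is_surj)

definition grad_\<phi> :: "'a \<Rightarrow> 'a" where
  "grad_\<phi> u = P u - u"

text \<open>\<open>grad_\<phi>\<close> is \<open>grad g\<close> composed with \<open>P\<close>, so
  the Lipschitz constants \<open>L\<close> and \<open>1 / (1 - L)\<close> multiply.\<close>

lemma lipschitz_grad_\<phi>: "(L / (1 - L))-lipschitz_on UNIV grad_\<phi>"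
proof (rule lipschitz_onI)
  fix u u'
  have "norm (grad_\<phi> u - grad_\<phi> u') \<le> L * norm (P u - P u')"
    using norm_grad_diff_le[of "P u" "P u'"] by (simp add: grad_inv_denoiser grad_\<phi>_def)
  also have "\<dots> \<le> L * (norm (u - u') / (1 - L))"
    by (intro mult_left_mono norm_inv_denoiser_diff_le L_nonneg)
  finally show "dist (grad_\<phi> u) (grad_\<phi> u') \<le> L / (1 - L) * dist u u'"
    by (simp add: dist_norm)
qed (use L_nonneg contractive in auto)

text \<open>
  Up to \<open>\<parallel>u\<parallel>\<^sup>2/2\<close>, the function \<open>\<phi>\<close> is the conjugate of \<open>q v = \<parallel>v\<parallel>\<^sup>2/2 - g v\<close>, whose gradient is the
  denoiser. Hence the linearisation error of \<open>\<phi>\<close> is governed by the Bregman distance of \<open>q\<close>.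
\<close>

definition bregman :: "'a \<Rightarrow> 'a \<Rightarrow> real" where
  "bregman v v' = 1 / 2 * (norm (v - v'))\<^sup>2 - (g v - g v' - grad g v' \<bullet> (v - v'))"

text \<open>Conjugation swaps the arguments of a Bregman distance, hence \<open>P u\<close> comes
  first.\<close>

lemma \<phi>_linearisation:
  "\<phi> u' - \<phi> u - grad_\<phi> u \<bullet> (u' - u) = bregman (P u) (P u') - 1 / 2 * (norm (u' - u))\<^sup>2"
  unfolding \<phi>_def grad_\<phi>_def bregman_def grad_inv_denoiser
  by (simp add: power2_norm_eq_inner inner_diff_left inner_diff_right inner_commute algebra_simps)

text \<open>Strong convexity of \<open>q\<close> with modulus \<open>1 - L\<close>.\<close>

lemma bregman_ge: "(1 - L) / 2 * (norm (v - v'))\<^sup>2 \<le> bregman v v'"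
  using lipschitz_grad_upper_bound[OF GDERIV_g lipschitz, of v v']
  by (simp add: bregman_def diff_divide_distrib left_diff_distrib)

text \<open>The Bregman distances in both orders add up to the inner product of
  \<open>u - u'\<close> and \<open>P u - P u'\<close>. Bounding the reversed one below by strong
  convexity leaves a concave quadratic in \<open>b\<close>.\<close>

lemma bregman_upper: "bregman (P u) (P u') \<le> 1 / (2 * (1 - L)) * (norm (u - u'))\<^sup>2"
proof -
  define a b c where "a = norm (u - u')" and "b = norm (P u - P u')" and "c = a / (1 - L)"
  have a: "a = (1 - L) * c"
    using contractive by (simp add: c_def)
  have "bregman (P u) (P u') = (u - u') \<bullet> (P u - P u') - bregman (P u') (P u)"
    unfolding bregman_def grad_inv_denoiser
    by (simp add: power2_norm_eq_inner inner_diff_left inner_diff_right inner_commute algebra_simps)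
  also have "\<dots> \<le> a * b - (1 - L) / 2 * b\<^sup>2"
    using bregman_ge[of "P u'" "P u"] norm_cauchy_schwarz[of "u - u'" "P u - P u'"]
    by (simp add: norm_minus_commute a_def b_def)
  \<comment> \<open>\<open>c\<close> is the maximiser of this quadratic in \<open>b\<close>.\<close>
  also have "\<dots> = (1 - L) / 2 * c\<^sup>2 - (1 - L) / 2 * (b - c)\<^sup>2"
    unfolding a power2_eq_square by (simp add: field_simps)
  also have "\<dots> \<le> (1 - L) / 2 * c\<^sup>2"
    using contractive by simp
  also have "\<dots> = c / 2 * a"
    by (simp add: a power2_eq_square)
  also have "\<dots> = 1 / (2 * (1 - L)) * a\<^sup>2"
    by (simp add: c_def power2_eq_square)
  finally show ?thesis
    by (simp only: a_def)
qed

text \<open>Cocoercivity: minimise the quadratic upper model of \<open>q\<close> around \<open>P u\<close>.\<close>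

lemma bregman_lower: "1 / (2 * (1 + L)) * (norm (u - u'))\<^sup>2 \<le> bregman (P u) (P u')"
proof -
  \<comment> \<open>The gradient of \<open>\<lambda>v. bregman v (P u')\<close> at
    \<open>P u\<close> is \<open>u - u'\<close>, so \<open>v\<close> is a gradient step from
    \<open>P u\<close>; \<open>t\<close> is the step length that fits smoothness constant
    \<open>1 + L\<close>.\<close>
  define t where "t = 1 / (1 + L)"
  define v where "v = P u - t *\<^sub>R (u - u')"
  have t: "t * (1 + L) = 1"
    using L_nonneg by (simp add: t_def)
  have "0 \<le> (1 - L) / 2 * (norm (v - P u'))\<^sup>2"
    using contractive by simp
  also have "\<dots> \<le> bregman v (P u')"
    by (rule bregman_ge)
  also have "\<dots> \<le> bregman (P u) (P u') + (u - u') \<bullet> (v - P u) + (1 + L) / 2 * (norm (v - P u))\<^sup>2"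
  proof -
    have "g (P u) + (P u - u) \<bullet> (v - P u) - L / 2 * (norm (v - P u))\<^sup>2 \<le> g v"
      using lipschitz_grad_lower_bound[OF GDERIV_g lipschitz, of "P u" v]
      by (simp add: grad_inv_denoiser)
    then show ?thesis
      unfolding bregman_def grad_inv_denoiser
      by (simp add: power2_norm_eq_inner inner_diff_left inner_diff_right inner_commute field_simps)
  qed
  also have "\<dots> = bregman (P u) (P u') - t * (norm (u - u'))\<^sup>2 + (t * (1 + L)) * t / 2 * (norm (u - u'))\<^sup>2"
    by (simp add: v_def power_mult_distrib power2_eq_square flip: power2_norm_eq_inner)
  also have "\<dots> = bregman (P u) (P u') - t / 2 * (norm (u - u'))\<^sup>2"
    unfolding t by simp
  also have "t / 2 = 1 / (2 * (1 + L))"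
    by (simp add: t_def)
  finally show ?thesis
    by simp
qed

text \<open>Half the modulus is the amount by which the cocoercivity constant
  \<open>1 / (2 * (1 + L))\<close> falls short of the subtracted \<open>1 / 2\<close>.\<close>

lemma \<phi>_weakly_convex:
  "\<phi> u + grad_\<phi> u \<bullet> (u' - u) - L / (L + 1) / 2 * (norm (u' - u))\<^sup>2 \<le> \<phi> u'"
proof -
  have "1 / (2 * (1 + L)) - 1 / 2 = - (L / (L + 1) / 2)"
    using L_nonneg by (simp add: field_simps)
  then have "1 / (2 * (1 + L)) * (norm (u' - u))\<^sup>2 - 1 / 2 * (norm (u' - u))\<^sup>2
      = - (L / (L + 1) / 2) * (norm (u' - u))\<^sup>2"
    unfolding left_diff_distrib[symmetric] by (rule arg_cong)
  then show ?thesis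
    using \<phi>_linearisation[of u' u] bregman_lower[of u u'] by (simp add: norm_minus_commute)
qed

text \<open>The lower and upper Bregman estimates bound the linearisation error by \<open>?c\<close>
  times the squared distance, so the error divided by the distance tends to 0.\<close>

lemma GDERIV_\<phi>: "GDERIV \<phi> u :> grad_\<phi> u"
proof -
  let ?c = "L / (1 - L) / 2"
  have c: "0 \<le> ?c" "L / (L + 1) / 2 \<le> ?c"
    using L_nonneg contractive by (auto intro!: divide_left_mono)
  have 1: "1 / (2 * (1 - L)) - 1 / 2 = ?c"
    using contractive by (simp add: field_simps)
  have bound: "\<bar>\<phi> u' - \<phi> u - grad_\<phi> u \<bullet> (u' - u)\<bar> \<le> ?c * (norm (u' - u))\<^sup>2" for u'
  proof (rule abs_leI)
    have "\<phi> u' - \<phi> u - grad_\<phi> u \<bullet> (u' - u)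
        \<le> (1 / (2 * (1 - L)) - 1 / 2) * (norm (u' - u))\<^sup>2"
      unfolding \<phi>_linearisation left_diff_distrib
      using bregman_upper[of u u'] by (simp add: norm_minus_commute)
    then show "\<phi> u' - \<phi> u - grad_\<phi> u \<bullet> (u' - u) \<le> ?c * (norm (u' - u))\<^sup>2"
      unfolding 1 .
    show "- (\<phi> u' - \<phi> u - grad_\<phi> u \<bullet> (u' - u)) \<le> ?c * (norm (u' - u))\<^sup>2"
      using \<phi>_weakly_convex[of u u'] mult_right_mono[OF c(2), of "(norm (u' - u))\<^sup>2"] by simp
  qed
  have "((\<lambda>u'. norm (\<phi> u' - \<phi> u - (u' - u) \<bullet> grad_\<phi> u) / norm (u' - u)) \<longlongrightarrow> 0) (at u)"
  proof (rule Lim_null_comparison)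
    show "\<forall>\<^sub>F u' in at u. norm (norm (\<phi> u' - \<phi> u - (u' - u) \<bullet> grad_\<phi> u) / norm (u' - u))
        \<le> ?c * norm (u' - u)"
    proof (rule eventually_at_filter[THEN iffD2], rule always_eventually, intro allI impI)
      fix u' assume "u' \<noteq> u"
      then show "norm (norm (\<phi> u' - \<phi> u - (u' - u) \<bullet> grad_\<phi> u) / norm (u' - u)) \<le> ?c * norm (u' - u)"
        using bound[of u']
        by (simp add: divide_le_eq inner_commute power2_eq_square)
    qed
    have "((\<lambda>u'. ?c * norm (u' - u)) \<longlongrightarrow> ?c * norm (u - u)) (at u)"
      by (intro tendsto_intros)
    then show "((\<lambda>u'. ?c * norm (u' - u)) \<longlongrightarrow> 0) (at u)"
      by simp
  qed
  then show ?thesis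
    by (simp add: gderiv_def has_derivative_iff_norm bounded_linear_inner_left)
qed

end

section \<open>Square-summable increments and trapping\<close>

text \<open>For \<open>K \<ge> 2 * m + 1\<close> the set \<open>{m..K}\<close> has at least
  \<open>K / 2\<close> elements, so \<open>K\<close> times the squared minimum is at most twice the
  whole sum.\<close>

lemma Min_bigo_inverse_sqrt:
  fixes a :: "nat \<Rightarrow> real"
  assumes nonneg: "\<And>k. 0 \<le> a k" and summable: "summable (\<lambda>k. (a k)\<^sup>2)"
  shows "(\<lambda>K. Min (a ` {m..K})) \<in> O(\<lambda>K. 1 / sqrt (real K))"
proof (rule bigoI)
  define c where "c = sqrt (2 * (\<Sum>k. (a k)\<^sup>2))"
  show "\<forall>\<^sub>F K in sequentially. norm (Min (a ` {m..K})) \<le> c * norm (1 / sqrt (real K))"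
    using eventually_ge_at_top[of "2 * m + 1"]
  proof eventually_elim
    case (elim K)
    define \<mu> where "\<mu> = Min (a ` {m..K})"
    have K: "m \<le> K" "0 < real K" "real K \<le> 2 * real (card {m..K})"
      using elim by auto
    have "\<mu> \<in> a ` {m..K}"
      unfolding \<mu>_def using K by (intro Min_in) auto
    then have \<mu>: "0 \<le> \<mu>"
      using nonneg by auto
    have "real K * \<mu>\<^sup>2 \<le> 2 * (real (card {m..K}) * \<mu>\<^sup>2)"
      using mult_right_mono[OF K(3), of "\<mu>\<^sup>2"] by simp
    also have "real (card {m..K}) * \<mu>\<^sup>2 \<le> (\<Sum>k\<in>{m..K}. (a k)\<^sup>2)"
      using \<mu> by (intro sum_bounded_below power_mono) (auto simp: \<mu>_def)
    also have "\<dots> \<le> (\<Sum>k. (a k)\<^sup>2)"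
      using summable by (intro sum_le_suminf) auto
    finally have "sqrt (real K * \<mu>\<^sup>2) \<le> c"
      unfolding c_def by simp
    then show ?case
      using \<mu> K by (simp add: real_sqrt_mult \<mu>_def[symmetric] pos_le_divide_eq mult.commute)
  qed
qed

lemma summable_square_sum:
  fixes a b :: "nat \<Rightarrow> real"
  assumes "summable (\<lambda>k. (a k)\<^sup>2)" "summable (\<lambda>k. (b k)\<^sup>2)"
  shows "summable (\<lambda>k. (s * a k + t * b k)\<^sup>2)"
proof (rule summable_comparison_test')
  show "summable (\<lambda>k. 2 * s\<^sup>2 * (a k)\<^sup>2 + 2 * t\<^sup>2 * (b k)\<^sup>2)"
    using assms by (intro summable_add summable_mult)
  have "(s * a k + t * b k)\<^sup>2 \<le> 2 * s\<^sup>2 * (a k)\<^sup>2 + 2 * t\<^sup>2 * (b k)\<^sup>2" for k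
    using sum_squares_bound[of "s * a k" "t * b k"] by (simp add: power2_sum power_mult_distrib)
  then show "norm ((s * a k + t * b k)\<^sup>2) \<le> 2 * s\<^sup>2 * (a k)\<^sup>2 + 2 * t\<^sup>2 * (b k)\<^sup>2" for k
    by simp
qed

lemma tendsto_zero_if_square_summable:
  fixes a :: "nat \<Rightarrow> 'a::real_normed_vector"
  assumes "summable (\<lambda>k. (norm (a k))\<^sup>2)"
  shows "a \<longlonglongrightarrow> 0"
  using tendsto_real_sqrt[OF summable_LIMSEQ_zero[OF assms]]
  by (simp add: tendsto_norm_zero_iff)

text \<open>
  The trapping argument: \<open>D\<close> stands for the values of the desingularising function along the merit
  values. The recursive inequality makes the increments summable as long as the iterates stay near
  the cluster point, and this in turn keeps them there.
\<close>

lemma cluster_point_trapping: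
  fixes x :: "nat \<Rightarrow> 'a::banach"
  assumes cluster: "strict_mono r" "(x \<circ> r) \<longlonglongrightarrow> x\<^sub>0"
    and increments: "(\<lambda>k. x k - x (k - 1)) \<longlonglongrightarrow> 0"
    and D: "D \<longlonglongrightarrow> 0" "\<And>k. k\<^sub>0 \<le> k \<Longrightarrow> 0 \<le> D k"
    and \<rho>: "0 < \<rho>" and M: "0 \<le> M"
    and step: "\<And>k. k\<^sub>0 \<le> k \<Longrightarrow> dist (x k) x\<^sub>0 < \<rho> \<Longrightarrow>
      (norm (x k - x (k - 1)))\<^sup>2
        \<le> M * (D k - D (Suc k)) * (norm (x k - x (k - 1)) + norm (x (k - 1) - x (k - 2)))"
    and decr: "\<And>k. k\<^sub>0 \<le> k \<Longrightarrow> D (Suc k) \<le> D k"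
  shows "convergent x"
proof -
  define a where "a k = norm (x k - x (k - 1))" for k
  have a_nonneg: "0 \<le> a k" for k
    by (simp add: a_def)
  have a_null: "a \<longlonglongrightarrow> 0"
    unfolding a_def using tendsto_norm[OF increments] by simp
  \<comment> \<open>Young's inequality, weighted so that only a quarter of \<open>s\<close> returns
    on the right.\<close>
  have mult_le_square: "d * s \<le> (s / 4 + d)\<^sup>2" for s d :: real
  proof -
    have "(s / 4 + d)\<^sup>2 - d * s = (s / 4 - d)\<^sup>2"
      by (simp add: power2_eq_square field_simps)
    then show ?thesis
      using zero_le_power2[of "s / 4 - d"] by linarith
  qed
  have rec: "a k \<le> a (k - 1) / 3 + 4 / 3 * (M * (D k - D (Suc k)))"
    if "k\<^sub>0 \<le> k" "2 \<le> k" "dist (x k) x\<^sub>0 < \<rho>" for k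
  proof -
    let ?s = "a k + a (k - 1)" and ?d = "M * (D k - D (Suc k))"
    have "(a k)\<^sup>2 \<le> ?d * ?s"
      using step[OF that(1,3)] unfolding a_def diff_diff_left one_add_one .
    also have "\<dots> \<le> (?s / 4 + ?d)\<^sup>2"
      by (rule mult_le_square)
    finally have "a k \<le> ?s / 4 + ?d"
    proof (rule power2_le_imp_le)
      show "0 \<le> ?s / 4 + ?d"
        using a_nonneg[of k] a_nonneg[of "k - 1"] M decr[OF that(1)]
        by (intro add_nonneg_nonneg mult_nonneg_nonneg divide_nonneg_nonneg) auto
    qed
    \<comment> \<open>Absorbing a quarter of \<open>a k\<close> on the left leaves the contraction
      factor \<open>1 / 3\<close>.\<close>
    moreover have "u \<le> u' / 3 + 4 / 3 * t" if "u \<le> (u + u') / 4 + t" for u u' t :: real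
      using that by (simp add: field_simps)
    ultimately show ?thesis
      by blast
  qed
  \<comment> \<open>The radius is shared in thirds by the starting distance, the path length
    \<open>S n\<close> and one further increment. The path length keeps to its share because
    \<open>a N / 2\<close> and \<open>2 * (M * D (Suc N))\<close> are both below
    \<open>\<rho> / 6\<close>.\<close>
  have "\<forall>\<^sub>F k in sequentially. a k < \<rho> / 3"
    using order_tendstoD(2)[OF a_null, of "\<rho> / 3"] \<rho> by simp
  then have "\<forall>\<^sub>F k in sequentially. \<forall>j\<ge>k. a j < \<rho> / 3"
    by (rule eventually_all_ge_at_top)
  moreover have "\<forall>\<^sub>F k in sequentially. M * D k < \<rho> / 12"
    using order_tendstoD(2)[OF tendsto_mult_right_zero[OF D(1)], of "\<rho> / 12" M] \<rho> by simp
  moreover have "\<forall>\<^sub>F k in sequentially. max k\<^sub>0 2 \<le> k"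
    by (rule eventually_ge_at_top)
  ultimately have "\<forall>\<^sub>F k in sequentially. (\<forall>j\<ge>k. a j < \<rho> / 3) \<and> M * D k < \<rho> / 12 \<and> max k\<^sub>0 2 \<le> k"
    by eventually_elim simp
  then have "\<forall>\<^sub>F j in sequentially. (\<forall>i\<ge>r j. a i < \<rho> / 3) \<and> M * D (r j) < \<rho> / 12 \<and> max k\<^sub>0 2 \<le> r j"
    using filterlim_subseq[OF cluster(1)] by (rule eventually_compose_filterlim)
  moreover have "\<forall>\<^sub>F j in sequentially. dist (x (r j)) x\<^sub>0 < \<rho> / 3"
    using tendstoD[OF cluster(2), of "\<rho> / 3"] \<rho> by simp
  ultimately have "\<forall>\<^sub>F j in sequentially. dist (x (r j)) x\<^sub>0 < \<rho> / 3 \<and> (\<forall>i\<ge>r j. a i < \<rho> / 3) \<and>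
      M * D (r j) < \<rho> / 12 \<and> max k\<^sub>0 2 \<le> r j"
    by eventually_elim simp
  then obtain j where "dist (x (r j)) x\<^sub>0 < \<rho> / 3 \<and> (\<forall>i\<ge>r j. a i < \<rho> / 3) \<and>
      M * D (r j) < \<rho> / 12 \<and> max k\<^sub>0 2 \<le> r j"
    using eventually_happens'[OF sequentially_bot] by blast
  then obtain N where N: "dist (x N) x\<^sub>0 < \<rho> / 3" "\<And>i. N \<le> i \<Longrightarrow> a i < \<rho> / 3" "M * D N < \<rho> / 12"
      "k\<^sub>0 \<le> N" "2 \<le> N"
    by auto
  define S where "S n = (\<Sum>j<n. a (Suc (N + j)))" for n
  have decr_N: "M * D (Suc (N + n)) \<le> M * D (N + n)" for n
    using M decr[of "N + n"] N(4) by (intro mult_left_mono) auto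
  \<comment> \<open>The weights \<open>1 / 2\<close> and \<open>2\<close> come from multiplying the
    recursion by \<open>3 / 2\<close>. Both claims go through one induction, as the recursion
    applies only once the new iterate is known to be near.\<close>
  have bound: "dist (x (N + n)) x\<^sub>0 \<le> dist (x N) x\<^sub>0 + S n \<and>
      S n + a (N + n) / 2 \<le> a N / 2 + 2 * (M * D (Suc N)) - 2 * (M * D (Suc (N + n)))" for n
  proof (induction n)
    case 0
    show ?case
      by (simp add: S_def)
  next
    case (Suc n)
    let ?k = "Suc (N + n)"
    have M_D: "0 \<le> M * D ?k"
      using M D(2) N(4) by simp
    have dist_le: "dist (x ?k) x\<^sub>0 \<le> dist (x (N + n)) x\<^sub>0 + a ?k"
      using dist_triangle[of "x ?k" x\<^sub>0 "x (N + n)"] by (simp add: a_def dist_norm)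
    also have "\<dots> < \<rho>"
      using Suc N(1) N(2)[of N] N(2)[of ?k] N(3) decr_N[of 0] M_D a_nonneg[of "N + n"]
      by simp
    finally have "a ?k \<le> a (N + n) / 3 + 4 / 3 * (M * (D ?k - D (Suc ?k)))"
      using rec[of ?k] N(4,5) by simp
    then show ?case
      using Suc dist_le by (simp add: S_def algebra_simps)
  qed
  have "S n \<le> \<rho>" for n
    using bound[of n] N(2)[of N] N(3) decr_N[of 0] a_nonneg[of "N + n"]
      mult_nonneg_nonneg[OF M D(2), of "Suc (N + n)"] N(4) \<rho> by simp
  then have "summable (\<lambda>j. a (Suc (N + j)))"
    unfolding S_def by (intro summableI_nonneg_bounded[where x = \<rho>] a_nonneg)
  then have "summable (\<lambda>j. norm (x (N + Suc j) - x (N + j)))"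
    by (simp add: a_def)
  then have "summable (\<lambda>j. x (N + Suc j) - x (N + j))"
    by (rule summable_norm_cancel)
  then have "convergent (\<lambda>n. \<Sum>j<n. x (N + Suc j) - x (N + j))"
    by (simp add: summable_iff_convergent)
  then have "convergent (\<lambda>n. x (N + n) - x N)"
    using sum_lessThan_telescope[of "\<lambda>j. x (N + j)"] by simp
  then have "convergent (\<lambda>n. x (N + n) - x N + x N)"
    by (intro convergent_add convergent_const)
  then show ?thesis
    using convergent_ignore_initial_segment[of x N] by (simp add: add.commute)
qed

section \<open>Decrease of the merit function in one step\<close>

text \<open>Completing the square in \<open>v\<close> must leave a negative coefficient at the
  squared increment of \<open>y\<close>. In the application \<open>\<beta> = L / (1 - L)\<close>,
  \<open>\<kappa> = L / (L + 1)\<close> and \<open>\<mu> = \<gamma> * Lh\<close>, and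
  \<open>bound\<close> is the condition on \<alpha>.\<close>

lemma descent_coefficient:
  fixes \<alpha> \<beta> \<kappa> \<mu> :: real
  assumes nonneg: "0 \<le> \<alpha>" "0 \<le> \<beta>" "0 \<le> \<mu>" and \<kappa>: "\<beta> / 3 \<le> \<kappa>"
    and bound: "(2 + \<mu>) * (\<alpha> + \<beta>\<^sup>2) < 1 - \<kappa> - 2 * \<mu>"
  shows "\<kappa> + \<mu> + 2 * \<alpha> + \<beta>\<^sup>2 + 2 * \<beta> * \<mu> + 2 * \<alpha> * \<mu> + (\<beta> + \<alpha> * \<mu>)\<^sup>2 / (1 + 2 * \<alpha>) < 1"
proof -
  have "0 \<le> \<mu> * (\<alpha> + \<beta>\<^sup>2)"
    using nonneg by simp
  then have le: "2 * \<alpha> + 2 * \<beta>\<^sup>2 + 2 * \<mu> + \<beta> / 3 \<le> 1"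
    using bound \<kappa> by (simp add: algebra_simps)
  then have half: "\<mu> \<le> 1 / 2" "\<alpha> \<le> 1 / 2 - \<beta>\<^sup>2 - \<beta> / 6" "\<alpha> \<le> 1 / 2"
    using nonneg zero_le_power2[of \<beta>] by linarith+
  have "\<alpha> * (2 * \<alpha> + 2 * \<mu>) \<le> \<alpha> * (1 - 2 * \<beta>\<^sup>2 - \<beta> / 3)"
    using le by (intro mult_left_mono nonneg) linarith
  moreover have "\<alpha> * (\<alpha> * \<mu>) \<le> \<alpha> * (2 * \<mu>)"
    using half nonneg by (intro mult_left_mono mult_right_mono) auto
  moreover have "0 \<le> (1 - \<beta>)\<^sup>2 - \<alpha> * (17 / 3 * \<beta> - 8 * \<beta>\<^sup>2)"
  proof -
    \<comment> \<open>\<open>289 / 288\<close> is the maximum of the quadratic in \<beta>, attained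
      at \<open>17 / 48\<close>.\<close>
    have "289 / 288 - (17 / 3 * \<beta> - 8 * \<beta>\<^sup>2) = (48 * \<beta> - 17)\<^sup>2 / 288"
      by (simp add: power2_eq_square field_simps)
    then have "17 / 3 * \<beta> - 8 * \<beta>\<^sup>2 \<le> 289 / 288"
      using zero_le_power2[of "48 * \<beta> - 17"] by linarith
    then have "\<alpha> * (17 / 3 * \<beta> - 8 * \<beta>\<^sup>2) \<le> \<alpha> * (289 / 288)"
      using nonneg by (intro mult_left_mono)
    also have "\<dots> \<le> (1 / 2 - \<beta>\<^sup>2 - \<beta> / 6) * (289 / 288)"
      using half by simp
    also have "\<dots> \<le> (1 - \<beta>)\<^sup>2"
    proof -
      have "(1 - \<beta>)\<^sup>2 - (1 / 2 - \<beta>\<^sup>2 - \<beta> / 6) * (289 / 288)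
          = 2 * (\<beta> - 11 / 24)\<^sup>2 + \<beta>\<^sup>2 / 288 + \<beta> / 1728 + 45 / 576"
        by (simp add: power2_eq_square field_simps)
      then show ?thesis
        using nonneg zero_le_power2[of \<beta>] zero_le_power2[of "\<beta> - 11 / 24"] by linarith
    qed
    finally show ?thesis
      by simp
  qed
  ultimately have "0 \<le> (1 - \<beta>)\<^sup>2 + \<alpha> - 6 * \<alpha> * \<beta> + 2 * \<alpha> * \<beta>\<^sup>2 - 2 * \<alpha>\<^sup>2 - \<alpha>\<^sup>2 * \<mu> + 4 * \<alpha> * \<beta>\<^sup>2"
    by (simp add: power2_eq_square algebra_simps)
  then have "0 \<le> \<mu> * ((1 - \<beta>)\<^sup>2 + \<alpha> - 6 * \<alpha> * \<beta> + 2 * \<alpha> * \<beta>\<^sup>2 - 2 * \<alpha>\<^sup>2 - \<alpha>\<^sup>2 * \<mu> + 4 * \<alpha> * \<beta>\<^sup>2)"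
    using nonneg by simp
  moreover have "\<mu> * (4 * \<alpha> * \<beta>\<^sup>2) \<le> (1 / 2) * (4 * \<alpha> * \<beta>\<^sup>2)"
    using half nonneg by (intro mult_right_mono) auto
  \<comment> \<open>The first factor on the right is chosen to make the total exactly
    \<open>\<kappa> + 2 * \<mu> + (2 + \<mu>) * (\<alpha> + \<beta>\<^sup>2)\<close>, which
    \<open>bound\<close> controls.\<close>
  ultimately have "(\<beta> + \<alpha> * \<mu>)\<^sup>2 \<le> (\<beta>\<^sup>2 + \<mu> * \<beta>\<^sup>2 + \<mu> - \<alpha> * \<mu> - 2 * \<beta> * \<mu>) * (1 + 2 * \<alpha>)"
    by (simp add: power2_eq_square algebra_simps)
  then have "(\<beta> + \<alpha> * \<mu>)\<^sup>2 / (1 + 2 * \<alpha>) \<le> \<beta>\<^sup>2 + \<mu> * \<beta>\<^sup>2 + \<mu> - \<alpha> * \<mu> - 2 * \<beta> * \<mu>"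
    using nonneg by (simp add: pos_divide_le_eq)
  then show ?thesis
    using bound by (simp add: algebra_simps)
qed

text \<open>
  One step of the iteration, with all function values multiplied by \<open>\<gamma>\<close>: \<open>F\<close>, \<open>P\<close>, \<open>H\<close> are the values
  of \<open>\<gamma> f\<close>, \<open>\<phi>\<close>, \<open>\<gamma> h\<close>, and \<open>c\<close> is \<open>\<gamma> \<nabla>h\<close>. Primes mark the new iterates, \<open>v\<close> and \<open>v\<^sub>0\<close> are the last two
  increments of \<open>x\<close>, and \<open>S\<close> is the increment of \<open>\<nabla>\<phi>\<close> along \<open>y\<close>.
\<close>

lemma merit_step:
  fixes v v\<^sub>0 x x' y y' z z' w c c' S :: "'a::real_inner"
  assumes "w = x + \<alpha> *\<^sub>R v" "x' = w + (z' - y')"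
    and e1: "y - z = \<alpha> *\<^sub>R v\<^sub>0 - v" and e2: "y - z = \<alpha> *\<^sub>R v - (y' - y) - S"
    and F: "F' + 1 / 2 * (norm (z' - (2 *\<^sub>R y' - c' - w)))\<^sup>2 \<le> F + 1 / 2 * (norm (z - (2 *\<^sub>R y' - c' - w)))\<^sup>2"
    and P: "P' + (w - y') \<bullet> (y - y') - \<kappa> / 2 * (norm (y - y'))\<^sup>2 \<le> P"
    and H: "H' \<le> H + c \<bullet> (y' - y) + \<mu> / 2 * (norm (y' - y))\<^sup>2"
  shows "2 * (P' + F' + H' + 1 / 2 * (norm (y' - x' - c'))\<^sup>2 - 1 / 2 * (norm (z' - x' - c'))\<^sup>2 + \<alpha>\<^sup>2 / 2 * (norm v)\<^sup>2)
       - 2 * (P + F + H + 1 / 2 * (norm (y - x - c))\<^sup>2 - 1 / 2 * (norm (z - x - c))\<^sup>2 + \<alpha>\<^sup>2 / 2 * (norm v\<^sub>0)\<^sup>2)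
     \<le> (\<kappa> + \<mu> - 2) * (norm (y' - y))\<^sup>2 - (1 + 2 * \<alpha>) * (norm v)\<^sup>2
       + 2 * (v \<bullet> ((1 + 2 * \<alpha>) *\<^sub>R (y' - y) + S - \<alpha> *\<^sub>R (c' - c)))
       - 2 * ((y' - y) \<bullet> S) + (norm S)\<^sup>2 + 2 * (S \<bullet> (c' - c))"
proof -
  \<comment> \<open>The two expressions \<open>e1\<close> and \<open>e2\<close> for the gap
    eliminate \<open>z\<close> and \<open>v\<^sub>0\<close>. Then twice the sum of \<open>F\<close>,
    \<open>P\<close> and \<open>H\<close> gives the claim up to an identity of inner
    products.\<close>
  define d p where "d = y' - y" and "p = \<alpha> *\<^sub>R v\<^sub>0"
  have y': "y' = y + d"
    by (simp add: d_def)
  have z: "z = y - \<alpha> *\<^sub>R v + d + S"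
    using e2 by (simp add: d_def algebra_simps)
  have p: "p = \<alpha> *\<^sub>R v - d - S + v"
    using e1 unfolding e2 by (simp add: p_def d_def algebra_simps)
  have p2: "\<alpha>\<^sup>2 / 2 * (norm v\<^sub>0)\<^sup>2 = 1 / 2 * (norm p)\<^sup>2"
    by (simp add: p_def power_mult_distrib)
  show ?thesis
    unfolding p2 using F P H unfolding assms(1,2) p z y' power2_norm_eq_inner
    by (simp add: inner_add_left inner_add_right inner_diff_left inner_diff_right
        inner_commute power2_eq_square algebra_simps)
qed

text \<open>The form is quadratic in \<open>v\<close> with leading coefficient \<open>- m\<close>.
  Completing the square around \<open>b\<close> leaves at most
  \<open>- \<delta> * (norm d)\<^sup>2\<close>, and \<open>norm b \<le> B * norm d\<close> lets the
  two negative squares dominate a multiple of \<open>(norm v)\<^sup>2\<close>.\<close>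

lemma merit_step_decrease:
  fixes \<alpha> \<beta> \<kappa> \<mu> :: real
  assumes nonneg: "0 \<le> \<alpha>" "0 \<le> \<beta>" "0 \<le> \<mu>" and \<kappa>: "\<beta> / 3 \<le> \<kappa>"
    and bound: "(2 + \<mu>) * (\<alpha> + \<beta>\<^sup>2) < 1 - \<kappa> - 2 * \<mu>"
  obtains \<epsilon> where "0 < \<epsilon>"
    and "\<And>v d S C :: 'a::real_inner. norm S \<le> \<beta> * norm d \<Longrightarrow> norm C \<le> \<mu> * norm d \<Longrightarrow>
      (\<kappa> + \<mu> - 2) * (norm d)\<^sup>2 - (1 + 2 * \<alpha>) * (norm v)\<^sup>2
       + 2 * (v \<bullet> ((1 + 2 * \<alpha>) *\<^sub>R d + S - \<alpha> *\<^sub>R C)) - 2 * (d \<bullet> S) + (norm S)\<^sup>2 + 2 * (S \<bullet> C)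
      \<le> - \<epsilon> * (norm v)\<^sup>2"
proof -
  define m where "m = 1 + 2 * \<alpha>"
  have m: "1 \<le> m"
    using nonneg by (simp add: m_def)
  define \<delta> where
    "\<delta> = 1 - (\<kappa> + \<mu> + 2 * \<alpha> + \<beta>\<^sup>2 + 2 * \<beta> * \<mu> + 2 * \<alpha> * \<mu> + (\<beta> + \<alpha> * \<mu>)\<^sup>2 / m)"
  have \<delta>: "0 < \<delta>"
    using descent_coefficient[OF assms] by (simp add: \<delta>_def m_def)
  define B where "B = 1 + (\<beta> + \<alpha> * \<mu>) / m"
  have B: "0 < B"
    using nonneg m by (simp add: B_def add_pos_nonneg)
  \<comment> \<open>The first bound lets \<open>2 * \<epsilon>\<close> be absorbed by the square of
    \<open>v - b\<close>, the second lets \<open>2 * \<epsilon> * B\<^sup>2\<close> be absorbed by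
    \<open>\<delta>\<close>.\<close>
  define \<epsilon> where "\<epsilon> = min (1 / 2) (\<delta> / (2 * B\<^sup>2))"
  have \<epsilon>: "0 < \<epsilon>" "\<epsilon> \<le> 1 / 2" "\<epsilon> * (2 * B\<^sup>2) \<le> \<delta>"
    using \<delta> B by (auto simp: \<epsilon>_def min_def field_simps)
  show ?thesis
  proof (rule that[OF \<epsilon>(1)])
    fix v d S C :: 'a
    assume S: "norm S \<le> \<beta> * norm d" and C: "norm C \<le> \<mu> * norm d"
    define q where "q = S - \<alpha> *\<^sub>R C"
    define b where "b = d + (1 / m) *\<^sub>R q"
    define n where "n = norm d"
    have "norm q \<le> norm S + \<alpha> * norm C"
      unfolding q_def using norm_triangle_ineq4[of S "\<alpha> *\<^sub>R C"] nonneg by simp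
    also have "\<dots> \<le> \<beta> * n + \<alpha> * (\<mu> * n)"
      unfolding n_def using S C nonneg by (intro add_mono mult_left_mono)
    finally have q: "norm q \<le> (\<beta> + \<alpha> * \<mu>) * n"
      by (simp add: algebra_simps)
    have "norm b \<le> n + norm q / m"
      unfolding b_def n_def using norm_triangle_ineq[of d "(1 / m) *\<^sub>R q"] m by simp
    also have "\<dots> \<le> n + ((\<beta> + \<alpha> * \<mu>) * n) / m"
      using q m by (intro add_left_mono divide_right_mono) auto
    also have "\<dots> = B * n"
      by (simp add: B_def algebra_simps)
    finally have b: "norm b \<le> B * n" .
    have q2: "(norm q)\<^sup>2 \<le> (\<beta> + \<alpha> * \<mu>)\<^sup>2 * n\<^sup>2"
      using power_mono[OF q, of 2] by (simp add: power_mult_distrib)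
    have S2: "(norm S)\<^sup>2 \<le> \<beta>\<^sup>2 * n\<^sup>2"
      using power_mono[OF S, of 2] by (simp add: power_mult_distrib n_def)
    have "S \<bullet> C \<le> norm S * norm C"
      by (rule norm_cauchy_schwarz)
    also have "\<dots> \<le> (\<beta> * n) * (\<mu> * n)"
      unfolding n_def using S C nonneg by (intro mult_mono) auto
    finally have SC: "S \<bullet> C \<le> \<beta> * \<mu> * n\<^sup>2"
      by (simp add: power2_eq_square mult_ac)
    have "- (d \<bullet> C) \<le> norm d * norm C"
      using norm_cauchy_schwarz[of "- d" C] by simp
    also have "\<dots> \<le> n * (\<mu> * n)"
      unfolding n_def using C by (intro mult_left_mono) auto
    finally have "- (d \<bullet> C) \<le> \<mu> * n\<^sup>2"
      by (simp add: power2_eq_square mult_ac)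
    then have dC: "\<alpha> * - (d \<bullet> C) \<le> \<alpha> * (\<mu> * n\<^sup>2)"
      using nonneg by (intro mult_left_mono)
    have mb: "m * (norm b)\<^sup>2 = m * n\<^sup>2 + 2 * (d \<bullet> q) + (norm q)\<^sup>2 / m"
      unfolding b_def n_def using m
      by (simp add: power2_norm_eq_inner inner_add_left inner_add_right inner_commute field_simps)
    have vb: "v \<bullet> (m *\<^sub>R d + S - \<alpha> *\<^sub>R C) = m * (v \<bullet> b)"
      unfolding b_def q_def using m by (simp add: inner_add_right inner_diff_right field_simps)
    have "(\<kappa> + \<mu> - 2) * n\<^sup>2 - m * (norm v)\<^sup>2
       + 2 * (v \<bullet> (m *\<^sub>R d + S - \<alpha> *\<^sub>R C)) - 2 * (d \<bullet> S) + (norm S)\<^sup>2 + 2 * (S \<bullet> C)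
      = - m * (norm (v - b))\<^sup>2 + (\<kappa> + \<mu> - 2 + m) * n\<^sup>2
       - 2 * \<alpha> * (d \<bullet> C) + (norm q)\<^sup>2 / m + (norm S)\<^sup>2 + 2 * (S \<bullet> C)" (is "?Q = _")
    proof -
      have "m * (norm (v - b))\<^sup>2 = m * (norm v)\<^sup>2 - 2 * (m * (v \<bullet> b)) + m * (norm b)\<^sup>2"
        by (simp add: power2_norm_eq_inner inner_diff_left inner_diff_right inner_commute algebra_simps)
      moreover have "d \<bullet> q = d \<bullet> S - \<alpha> * (d \<bullet> C)"
        by (simp add: q_def inner_diff_right)
      ultimately show ?thesis
        unfolding vb mb by (simp add: algebra_simps)
    qed
    also have "\<dots> \<le> - m * (norm (v - b))\<^sup>2 - \<delta> * n\<^sup>2"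
    proof -
      have "(norm q)\<^sup>2 / m \<le> (\<beta> + \<alpha> * \<mu>)\<^sup>2 / m * n\<^sup>2"
        using q2 m by (simp add: divide_right_mono)
      then show ?thesis
        using S2 SC dC unfolding \<delta>_def by (simp add: m_def algebra_simps)
    qed
    also have "\<dots> \<le> - 1 * (norm (v - b))\<^sup>2 - \<epsilon> * (2 * B\<^sup>2) * n\<^sup>2"
      using m \<epsilon> by (intro diff_mono mult_right_mono) auto
    also have "\<dots> \<le> - \<epsilon> * (norm v)\<^sup>2"
    proof -
      have "(norm v)\<^sup>2 \<le> (norm (v - b) + norm b)\<^sup>2"
        using norm_triangle_ineq[of "v - b" b] by (intro power_mono) auto
      also have "\<dots> \<le> 2 * (norm (v - b))\<^sup>2 + 2 * (norm b)\<^sup>2"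
        using sum_squares_bound[of "norm (v - b)" "norm b"] by (simp add: power2_sum)
      also have "(norm b)\<^sup>2 \<le> B\<^sup>2 * n\<^sup>2"
        using power_mono[OF b, of 2] by (simp add: power_mult_distrib)
      finally have "\<epsilon> * (norm v)\<^sup>2 \<le> \<epsilon> * (2 * (norm (v - b))\<^sup>2 + 2 * (B\<^sup>2 * n\<^sup>2))"
        using \<epsilon> by (intro mult_left_mono) auto
      moreover have "(2 * \<epsilon>) * (norm (v - b))\<^sup>2 \<le> 1 * (norm (v - b))\<^sup>2"
        using \<epsilon> by (intro mult_right_mono) auto
      ultimately show ?thesis
        by (simp add: algebra_simps)
    qed
    finally show "(\<kappa> + \<mu> - 2) * (norm d)\<^sup>2 - (1 + 2 * \<alpha>) * (norm v)\<^sup>2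
       + 2 * (v \<bullet> ((1 + 2 * \<alpha>) *\<^sub>R d + S - \<alpha> *\<^sub>R C)) - 2 * (d \<bullet> S) + (norm S)\<^sup>2 + 2 * (S \<bullet> C)
      \<le> - \<epsilon> * (norm v)\<^sup>2"
      unfolding n_def m_def .
  qed
qed

section \<open>Proximal points, subdifferentials and the KL inequality\<close>

lemma prox_le:
  assumes "y \<in> prox \<gamma> f p"
  shows "f y + ereal (1 / (2 * \<gamma>) * (norm (y - p))\<^sup>2) \<le> f u + ereal (1 / (2 * \<gamma>) * (norm (u - p))\<^sup>2)"
  using assms by (auto simp: prox_def is_arg_min_linorder)

lemma prox_finite:
  assumes "proper_fun f" "y \<in> prox \<gamma> f p"
  shows "\<bar>f y\<bar> \<noteq> \<infinity>"
proof -
  obtain u where "f u < \<infinity>"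
    using assms(1) by (auto simp: proper_fun_def effdom_def)
  with prox_le[OF assms(2), of u] have "f y \<noteq> \<infinity>"
    by auto
  then show ?thesis
    using assms(1) by (auto simp: proper_fun_def)
qed

text \<open>Expanding the square around \<open>y\<close> exhibits
  \<open>(1 / \<gamma>) *\<^sub>R (p - y)\<close> as a proximal subgradient of \<open>f\<close> at
  \<open>y\<close>.\<close>

lemma prox_lower_quadratic:
  fixes f :: "'a::euclidean_space \<Rightarrow> ereal"
  assumes "y \<in> prox \<gamma> f p"
  shows "f y + ereal (((1 / \<gamma>) *\<^sub>R (p - y)) \<bullet> (u - y) - 1 / (2 * \<gamma>) * (norm (u - y))\<^sup>2) \<le> f u"
proof -
  have "(norm (u - p))\<^sup>2 = (norm (y - p))\<^sup>2 - 2 * ((p - y) \<bullet> (u - y)) + (norm (u - y))\<^sup>2"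
    by (simp add: power2_norm_eq_inner inner_diff_left inner_diff_right inner_commute)
  then have "1 / (2 * \<gamma>) * (norm (u - p))\<^sup>2 = 1 / (2 * \<gamma>) * (norm (y - p))\<^sup>2
      - (((1 / \<gamma>) *\<^sub>R (p - y)) \<bullet> (u - y) - 1 / (2 * \<gamma>) * (norm (u - y))\<^sup>2)"
    by (simp add: diff_divide_distrib add_divide_distrib)
  then show ?thesis
    using prox_le[OF assms, of u] by (cases "f y"; cases "f u") auto
qed

text \<open>A quadratic minorant touching at \<open>x\<close> suffices: divided by the distance, its
  error is \<open>c * norm (y - x)\<close>, which tends to 0.\<close>

lemma frechet_subdiffI:
  fixes F :: "'a::euclidean_space \<Rightarrow> ereal"
  assumes finite: "\<bar>F x\<bar> \<noteq> \<infinity>"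
    and le: "\<And>y. F x + ereal (u \<bullet> (y - x) - c * (norm (y - x))\<^sup>2) \<le> F y"
  shows "u \<in> frechet_subdiff F x"
proof -
  let ?q = "\<lambda>y. (F y - F x - ereal (u \<bullet> (y - x))) / ereal (norm (y - x))"
  have "((\<lambda>y. ereal (- c * norm (y - x))) \<longlongrightarrow> ereal (- c * norm (x - x))) (at x)"
    by (intro tendsto_intros)
  then have "Liminf (at x) (\<lambda>y. ereal (- c * norm (y - x))) = 0"
    by (intro lim_imp_Liminf) (auto simp: zero_ereal_def)
  moreover have "Liminf (at x) (\<lambda>y. ereal (- c * norm (y - x))) \<le> Liminf (at x) ?q"
  proof (rule Liminf_mono, unfold eventually_at_filter, rule always_eventually, intro allI impI)
    fix y assume "y \<noteq> x"
    then show "ereal (- c * norm (y - x)) \<le> ?q y"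
      using finite le[of y]
      by (cases "F x"; cases "F y") (auto simp: pos_le_divide_eq power2_eq_square algebra_simps)
  qed
  ultimately show ?thesis
    using finite by (auto simp: frechet_subdiff_def effdom_def)
qed

lemma frechet_subdiff_subset_limiting: "frechet_subdiff F x \<subseteq> limiting_subdiff F x"
proof
  fix u assume "u \<in> frechet_subdiff F x"
  then show "u \<in> limiting_subdiff F x"
    unfolding limiting_subdiff_def
    by (intro CollectI exI[where x = "\<lambda>_. x"] exI[where x = "\<lambda>_. u"]) auto
qed

text \<open>\<open>lsc\<close> is stated with the punctured filter \<open>at x\<close>; the point
  itself is covered by \<open>a < F x\<close>.\<close>

lemma lsc_less_eventually:
  assumes "lsc F" "a < F x"
  shows "\<forall>\<^sub>F y in nhds x. a < F y"
proof -
  have "a < Liminf (at x) F"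
    using assms by (auto simp: lsc_def intro: less_le_trans)
  then show ?thesis
    using assms(2) by (simp add: eventually_nhds_conv_at less_LiminfD)
qed

text \<open>
  The merit function is not assumed to have the KL property, only the objective is. If the merit value
  \<open>c + t\<close> exceeds the objective value \<open>b\<close> by at most \<open>K \<delta>\<^sup>2\<close>, then either \<open>t \<le> 2 (b - c)\<close>, and \<open>\<phi>\<close> applies at
  \<open>t / 2\<close>, or \<open>t \<le> 2 K \<delta>\<^sup>2\<close>, and the square root desingularises.
\<close>

lemma KL_at_inexact:
  fixes F :: "'a::euclidean_space \<Rightarrow> ereal"
  assumes KL: "KL_at F a" and Fa: "F a = ereal c" and K: "0 \<le> K"
  obtains \<eta> U \<psi> M where "0 < \<eta>" "open U" "a \<in> U" "(\<psi> \<longlongrightarrow> (0::real)) (at_right 0)" "\<psi> 0 = 0" "0 \<le> M"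
    and "\<And>s t. 0 \<le> s \<Longrightarrow> s \<le> t \<Longrightarrow> t < \<eta> \<Longrightarrow> \<psi> s \<le> \<psi> t"
    and "\<And>p b u s t \<delta>. p \<in> U \<Longrightarrow> F p = ereal b \<Longrightarrow> b - c < \<eta> \<Longrightarrow> u \<in> limiting_subdiff F p \<Longrightarrow>
      0 \<le> s \<Longrightarrow> s \<le> t \<Longrightarrow> 0 < t \<Longrightarrow> t < \<eta> \<Longrightarrow> 0 \<le> \<delta> \<Longrightarrow> t - K * \<delta>\<^sup>2 \<le> b - c \<Longrightarrow> norm u \<le> K * \<delta> \<Longrightarrow>
      t - s \<le> M * \<delta> * (\<psi> t - \<psi> s)"
proof -
  obtain E U \<phi> \<phi>' where E: "(0::ereal) < E" and U: "open U" "a \<in> U"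
    and cont: "continuous_on {t. 0 \<le> t \<and> ereal t < E} \<phi>"
    and conc: "concave_on {t. 0 \<le> t \<and> ereal t < E} \<phi>"
    and zero: "\<phi> 0 = (0::real)"
    and deriv: "\<And>t. 0 < t \<Longrightarrow> ereal t < E \<Longrightarrow> (\<phi> has_real_derivative \<phi>' t) (at t) \<and> 0 < \<phi>' t"
    and KL_le: "\<And>p. p \<in> U \<Longrightarrow> F a < F p \<Longrightarrow> F p < F a + E \<Longrightarrow>
        1 \<le> ereal (\<phi>' (real_of_ereal (F p - F a))) * edist_set 0 (limiting_subdiff F p)"
    using KL unfolding KL_at_def by blast
  \<comment> \<open>Shrinking \<open>E\<close> to a real bound lets the rest of the argument run
    over the reals.\<close>
  obtain \<eta> where "0 < ereal \<eta>" "ereal \<eta> < E"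
    using ereal_dense2[OF E] by blast
  then have \<eta>: "0 < \<eta>" "ereal \<eta> < E"
    by simp_all
  have less_E: "ereal t < E" if "t < \<eta>" for t
    using that \<eta>(2) by (meson less_ereal.simps(1) order.strict_trans)
  have sub: "{0..<\<eta>} \<subseteq> {t. 0 \<le> t \<and> ereal t < E}"
    using less_E by auto
  have conv: "convex_on {0..<\<eta>} (\<lambda>t. - \<phi> t)"
    using conc unfolding concave_on_def by (rule convex_on_subset[OF _ sub]) simp
  have tangent: "\<phi> s - \<phi> t \<le> \<phi>' t * (s - t)" if "0 < t" "t < \<eta>" "0 \<le> s" "s < \<eta>" for s t
  proof -
    have "t \<in> interior {0..<\<eta>}"
      using that by (intro interiorI[of "{0<..<\<eta>}"]) auto
    moreover have "((\<lambda>t. - \<phi> t) has_real_derivative - \<phi>' t) (at t within {0..<\<eta>})"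
      by (rule DERIV_minus[OF has_field_derivative_at_within[OF
            conjunct1[OF deriv[OF that(1) less_E[OF that(2)]]]]])
    ultimately have "- \<phi>' t * (s - t) \<le> - \<phi> s - - \<phi> t"
      using that(3,4) by (intro convex_on_imp_above_tangent[OF conv]) simp_all
    then show ?thesis
      by simp
  qed
  have antimono: "\<phi>' t \<le> \<phi>' s" if "0 < s" "s \<le> t" "t < \<eta>" for s t
  proof (cases "s = t")
    case False
    have "\<phi> t - \<phi> s \<le> \<phi>' s * (t - s)" "\<phi> s - \<phi> t \<le> \<phi>' t * (s - t)"
      using that by (auto intro!: tangent)
    then have "0 \<le> (\<phi>' s - \<phi>' t) * (t - s)"
      by (simp add: algebra_simps)
    then show ?thesis
      using False that by (simp add: zero_le_mult_iff)
  qed simp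
  have \<phi>_mono: "\<phi>' (t / 2) * ((t - s) / 2) \<le> \<phi> (t / 2) - \<phi> (s / 2)" "\<phi> (s / 2) \<le> \<phi> (t / 2)"
    if "0 \<le> s" "s \<le> t" "0 < t" "t < \<eta>" for s t
  proof -
    show le: "\<phi>' (t / 2) * ((t - s) / 2) \<le> \<phi> (t / 2) - \<phi> (s / 2)"
    proof -
      have "\<phi> (s / 2) - \<phi> (t / 2) \<le> \<phi>' (t / 2) * (s / 2 - t / 2)"
        using that by (intro tangent) auto
      then show ?thesis
        by (simp add: algebra_simps diff_divide_distrib)
    qed
    have "0 \<le> \<phi>' (t / 2) * ((t - s) / 2)"
      using deriv[of "t / 2"] less_E[of "t / 2"] that by simp
    with le show "\<phi> (s / 2) \<le> \<phi> (t / 2)"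
      by simp
  qed
  \<comment> \<open>The halved argument fits the case \<open>t / 2 \<le> b - c\<close>, and the
    factor \<open>2\<close> undoes the halving in the derivative. In \<open>M\<close>, the summand
    \<open>K\<close> serves this case and the other one the square root.\<close>
  define \<psi> where "\<psi> t = 2 * \<phi> (t / 2) + sqrt t" for t
  define M where "M = K + 2 * sqrt (2 * K)"
  have M: "0 \<le> M" "K \<le> M" "2 * sqrt (2 * K) \<le> M"
    using K by (auto simp: M_def)
  show ?thesis
  proof (rule that[of \<eta> U \<psi> M])
    show "0 < \<eta>" "open U" "a \<in> U" "0 \<le> M"
      by fact+
    show "\<psi> 0 = 0"
      by (simp add: \<psi>_def zero)
    have "continuous_on {0..\<eta> / 2} \<phi>"
      using less_E \<eta>(1) by (intro continuous_on_subset[OF cont]) auto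
    then have "(\<phi> \<longlongrightarrow> \<phi> 0) (at 0 within {0..\<eta> / 2})"
      using \<eta>(1) by (simp add: continuous_on_def)
    then have "(\<phi> \<longlongrightarrow> 0) (at_right 0)"
      using \<eta>(1) zero by (simp add: at_within_Icc_at_right)
    moreover have "filterlim (\<lambda>t::real. t / 2) (at_right 0) (at_right 0)"
      by (auto simp: filterlim_at intro!: tendsto_eq_intros eventually_at_rightI[of 0 1])
    ultimately have "((\<lambda>t. \<phi> (t / 2)) \<longlongrightarrow> 0) (at_right 0)"
      by (rule filterlim_compose)
    then have "((\<lambda>t. 2 * \<phi> (t / 2) + sqrt t) \<longlongrightarrow> 2 * 0 + sqrt 0) (at_right 0)"
      by (intro tendsto_intros)
    then show "(\<psi> \<longlongrightarrow> 0) (at_right 0)"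
      by (simp add: \<psi>_def[abs_def])
    show "\<psi> s \<le> \<psi> t" if "0 \<le> s" "s \<le> t" "t < \<eta>" for s t
    proof (cases "t = 0")
      case False
      then show ?thesis
        using \<phi>_mono(2)[of s t] that unfolding \<psi>_def by (intro add_mono mult_left_mono) auto
    qed (use that in simp)
    fix p b u s t \<delta>
    assume p: "p \<in> U" "F p = ereal b" "b - c < \<eta>" "u \<in> limiting_subdiff F p"
      and st: "0 \<le> s" "s \<le> t" "0 < t" "t < \<eta>"
      and \<delta>: "0 \<le> \<delta>" "t - K * \<delta>\<^sup>2 \<le> b - c" "norm u \<le> K * \<delta>"
    have sqrt_mono: "sqrt s \<le> sqrt t"
      using st by simp
    have \<psi>_diff: "\<psi> t - \<psi> s = 2 * (\<phi> (t / 2) - \<phi> (s / 2)) + (sqrt t - sqrt s)"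
      by (simp add: \<psi>_def)
    have "2 * (\<phi>' (t / 2) * ((t - s) / 2)) \<le> 2 * (\<phi> (t / 2) - \<phi> (s / 2))"
      using \<phi>_mono(1)[OF st] by (rule mult_left_mono) simp
    also have "\<dots> \<le> \<psi> t - \<psi> s"
      unfolding \<psi>_diff using sqrt_mono by simp
    finally have gap: "2 * (\<phi>' (t / 2) * ((t - s) / 2)) \<le> \<psi> t - \<psi> s" .
    show "t - s \<le> M * \<delta> * (\<psi> t - \<psi> s)"
    proof (cases "t / 2 \<le> b - c")
      case True
      let ?d = "\<phi>' (b - c)"
      have bc: "0 < b - c"
        using True st by simp
      have d: "0 < ?d"
        using deriv[of "b - c"] bc less_E p by simp
      have "ereal b < ereal c + E"
        using less_E[OF p(3)] by (cases E) auto
      then have "1 \<le> ereal ?d * edist_set 0 (limiting_subdiff F p)"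
        using KL_le[OF p(1)] p(2) Fa bc by simp
      also have "\<dots> \<le> ereal ?d * ereal (norm u)"
        using d p(4) unfolding edist_set_def
        by (intro ereal_mult_left_mono INF_lower2[of u]) auto
      finally have "1 \<le> ?d * norm u"
        by (simp add: one_ereal_def)
      \<comment> \<open>By concavity \<open>\<phi>'\<close> is antitone, so its value at
        \<open>b - c\<close> is at most that at \<open>t / 2\<close>.\<close>
      also have "\<dots> \<le> \<phi>' (t / 2) * (K * \<delta>)"
        using antimono[of "t / 2" "b - c"] True st p d \<delta> by (intro mult_mono) auto
      finally have "1 * (t - s) \<le> \<phi>' (t / 2) * (K * \<delta>) * (t - s)"
        using st by (intro mult_right_mono) auto
      also have "\<dots> = K * \<delta> * (2 * (\<phi>' (t / 2) * ((t - s) / 2)))"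
        by simp
      also have "\<dots> \<le> K * \<delta> * (\<psi> t - \<psi> s)"
        using gap K \<delta> by (intro mult_left_mono) auto
      also have "\<dots> \<le> M * \<delta> * (\<psi> t - \<psi> s)"
        unfolding \<psi>_diff using \<phi>_mono(2)[OF st] sqrt_mono M \<delta>
        by (intro mult_right_mono) auto
      finally show ?thesis
        by simp
    next
      case False
      then have "t \<le> 2 * K * \<delta>\<^sup>2"
        using \<delta> by simp
      then have "sqrt t \<le> sqrt (2 * K * \<delta>\<^sup>2)"
        by simp
      also have "\<dots> = sqrt (2 * K) * \<delta>"
        using \<delta> by (simp add: real_sqrt_mult)
      finally have t: "sqrt t \<le> sqrt (2 * K) * \<delta>" .
      have "t - s = (sqrt t + sqrt s) * (sqrt t - sqrt s)"
        using st by (simp add: algebra_simps)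
      also have "\<dots> \<le> (2 * sqrt (2 * K) * \<delta>) * (sqrt t - sqrt s)"
      proof (rule mult_right_mono)
        show "sqrt t + sqrt s \<le> 2 * sqrt (2 * K) * \<delta>"
          using add_mono[OF t order_trans[OF sqrt_mono t]] unfolding mult_2 distrib_right .
      qed (use sqrt_mono in simp)
      also have "\<dots> \<le> M * \<delta> * (sqrt t - sqrt s)"
        using M \<delta> sqrt_mono by (intro mult_right_mono) auto
      also have "\<dots> \<le> M * \<delta> * (\<psi> t - \<psi> s)"
        unfolding \<psi>_diff using \<phi>_mono(2)[OF st] M \<delta> by (intro mult_left_mono) auto
      finally show ?thesis .
    qed
  qed
qed

section \<open>The extrapolated iteration\<close>

text \<open>\<open>\<alpha>_bound\<close> is the theorem's condition on \<alpha> multiplied out,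
  with \<open>\<gamma> * l = L / (L + 1)\<close> and \<open>\<gamma> * Lf1 = L / (1 - L)\<close>
  inserted.\<close>

locale extrapolated_dys = contractive_denoiser g L
  for g :: "'a::euclidean_space \<Rightarrow> real" and L :: real +
  fixes f :: "'a \<Rightarrow> ereal" and h :: "'a \<Rightarrow> real"
    and \<alpha> \<gamma> Lh :: real and w y z x :: "nat \<Rightarrow> 'a"
  assumes proper: "proper_fun f" and lsc: "lsc f"
    and h_differentiable: "\<And>v. h differentiable (at v)"
    and h_lipschitz: "Lh-lipschitz_on UNIV (grad h)"
    and f_bounded_below: "\<exists>m::real. \<forall>v. ereal m \<le> f v"
    and \<gamma>_pos: "0 < \<gamma>" and \<alpha>_nonneg: "0 \<le> \<alpha>"
    and \<alpha>_bound: "(2 + \<gamma> * Lh) * (\<alpha> + (L / (1 - L))\<^sup>2) < 1 - L / (L + 1) - 2 * (\<gamma> * Lh)"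
    and iteration: "pnp_dys \<alpha> \<gamma> f g h w y z x"
    and bounded_iterates: "bounded ((\<lambda>k. (y k, z k, x k)) ` {1..})"
begin

section \<open>Recursion identities and descent of the merit values\<close>

lemma Lh_nonneg: "0 \<le> Lh"
  using h_lipschitz by (rule lipschitz_on_nonneg)

lemma GDERIV_h: "GDERIV h v :> grad h v"
  using h_differentiable by (rule differentiable_imp_GDERIV_grad)

text \<open>Truncated subtraction gives \<open>v 0 = 0\<close>, in agreement with the
  initialisation.\<close>

definition v where "v k = x k - x (k - 1)"

definition e where "e k = y k - z k"

lemma v_Suc: "v (Suc k) = x (Suc k) - x k"
  by (simp add: v_def)

lemmas step = iteration[unfolded pnp_dys_def Suc_eq_plus1[symmetric], rule_format]

lemma w_eq: "w k = x k + \<alpha> *\<^sub>R v k"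
  using iteration by (simp add: pnp_dys_def v_def)

lemma y_Suc: "y (Suc k) = denoiser g (w k)"
  using step[of k] by blast

lemma z_Suc: "z (Suc k) \<in> prox \<gamma> f (2 *\<^sub>R y (Suc k) - \<gamma> *\<^sub>R grad h (y (Suc k)) - w k)"
  using step[of k] by blast

lemma x_Suc: "x (Suc k) = w k + (z (Suc k) - y (Suc k))"
  using step[of k] by blast

text \<open>The first-order condition for \<open>y (Suc k)\<close> as the proximal point of
  \<open>\<phi>\<close> at \<open>w k\<close>.\<close>

lemma grad_\<phi>_y: "grad_\<phi> (y (Suc k)) = w k - y (Suc k)"
  by (simp add: grad_\<phi>_def y_Suc)

lemma e_Suc: "e (Suc k) = \<alpha> *\<^sub>R v k - v (Suc k)"
  by (simp add: e_def v_Suc x_Suc w_eq)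

definition fz where "fz k = real_of_ereal (f (z k))"

lemma f_z: "f (z (Suc k)) = ereal (fz (Suc k))"
  using prox_finite[OF proper z_Suc] by (simp add: fz_def ereal_real)

text \<open>The part of the merit function without \<open>f\<close>: continuous in all arguments,
  hence bounded along bounded iterates.\<close>

definition G :: "'a \<Rightarrow> 'a \<Rightarrow> 'a \<Rightarrow> real" where
  "G p q r = 1 / \<gamma> * \<phi> p + h p + 1 / (2 * \<gamma>) * (norm (p - r - \<gamma> *\<^sub>R grad h p))\<^sup>2
     - 1 / (2 * \<gamma>) * (norm (q - r - \<gamma> *\<^sub>R grad h p))\<^sup>2"

definition \<Theta> :: "nat \<Rightarrow> real" where
  "\<Theta> k = G (y k) (z k) (x k) + fz k + \<alpha>\<^sup>2 / (2 * \<gamma>) * (norm (v (k - 1)))\<^sup>2"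

lemma merit_Theta_Suc:
  "merit_Theta \<alpha> \<gamma> f g h (y (Suc k)) (z (Suc k)) (x (Suc k)) (x (Suc k - 1)) (x (Suc k - 2))
    = ereal (\<Theta> (Suc k))"
proof -
  have "Suc k - 2 = k - 1"
    by simp
  then show ?thesis
    by (simp add: merit_Theta_def merit_H_def \<Theta>_def G_def phi_eq f_z v_def)
qed

text \<open>Scaled by \<open>2 * \<gamma>\<close>, the difference of merit values fits
  \<open>merit_step\<close>, and \<open>merit_step_decrease\<close> bounds the result; undoing the
  scaling gives the rate \<open>\<epsilon> / (2 * \<gamma>)\<close>.\<close>

lemma \<Theta>_decrease:
  obtains \<epsilon> where "0 < \<epsilon>" "\<And>k. \<Theta> (Suc (Suc k)) + \<epsilon> * (norm (v (Suc k)))\<^sup>2 \<le> \<Theta> (Suc k)"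
proof -
  define \<beta> where "\<beta> = L / (1 - L)"
  have \<beta>_nonneg: "0 \<le> \<beta>"
    using L_nonneg contractive by (simp add: \<beta>_def)
  \<comment> \<open>\<open>\<alpha>_bound\<close> forces \<open>\<beta> < 1\<close>, that is
    \<open>L < 1 / 2\<close>, and then \<open>L + 1 \<le> 3 * (1 - L)\<close>.\<close>
  have \<beta>: "\<beta> / 3 \<le> L / (L + 1)"
  proof -
    have "0 \<le> (\<gamma> * Lh) * (\<alpha> + \<beta>\<^sup>2)" "0 \<le> L / (L + 1)" "0 \<le> \<gamma> * Lh"
      using \<alpha>_nonneg \<gamma>_pos Lh_nonneg L_nonneg by auto
    then have "\<beta>\<^sup>2 < 1"
      using \<alpha>_bound \<alpha>_nonneg by (simp add: \<beta>_def[symmetric] algebra_simps)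
    then have "\<beta> < 1"
      using power_less_imp_less_base[of \<beta> 2 1] by simp
    then have "L < 1 / 2"
      using contractive by (simp add: \<beta>_def)
    then have "L * (L + 1) \<le> L * (3 * (1 - L))"
      using L_nonneg by (intro mult_left_mono) auto
    then show ?thesis
      using L_nonneg contractive by (simp add: \<beta>_def divide_le_eq le_divide_eq algebra_simps)
  qed
  have Lh': "0 \<le> \<gamma> * Lh"
    using \<gamma>_pos Lh_nonneg by simp
  obtain \<epsilon> where \<epsilon>: "0 < \<epsilon>"
    and decr: "\<And>v d S C :: 'a. norm S \<le> \<beta> * norm d \<Longrightarrow> norm C \<le> (\<gamma> * Lh) * norm d \<Longrightarrow>
      (L / (L + 1) + \<gamma> * Lh - 2) * (norm d)\<^sup>2 - (1 + 2 * \<alpha>) * (norm v)\<^sup>2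
       + 2 * (v \<bullet> ((1 + 2 * \<alpha>) *\<^sub>R d + S - \<alpha> *\<^sub>R C)) - 2 * (d \<bullet> S) + (norm S)\<^sup>2 + 2 * (S \<bullet> C)
      \<le> - \<epsilon> * (norm v)\<^sup>2"
    using merit_step_decrease[OF \<alpha>_nonneg \<beta>_nonneg Lh' \<beta> \<alpha>_bound[folded \<beta>_def]] by metis
  have "\<Theta> (Suc (Suc k)) + \<epsilon> / (2 * \<gamma>) * (norm (v (Suc k)))\<^sup>2 \<le> \<Theta> (Suc k)" for k
  proof -
    let ?y = "y (Suc k)" and ?y' = "y (Suc (Suc k))"
      and ?z = "z (Suc k)" and ?z' = "z (Suc (Suc k))"
      and ?x = "x (Suc k)" and ?x' = "x (Suc (Suc k))" and ?w = "w (Suc k)"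
    let ?S = "grad_\<phi> ?y' - grad_\<phi> ?y"
    let ?c = "\<gamma> *\<^sub>R grad h ?y" and ?c' = "\<gamma> *\<^sub>R grad h ?y'"
    have S: "norm ?S \<le> \<beta> * norm (?y' - ?y)"
      using lipschitz_on_normD[OF lipschitz_grad_\<phi>, of ?y' ?y] by (simp add: \<beta>_def)
    have C: "norm (?c' - ?c) \<le> (\<gamma> * Lh) * norm (?y' - ?y)"
      using lipschitz_on_normD[OF h_lipschitz, of ?y' ?y] \<gamma>_pos
      by (simp add: mult.assoc flip: scaleR_diff_right)
    have "2 * (\<phi> ?y' + \<gamma> * fz (Suc (Suc k)) + \<gamma> * h ?y' + 1 / 2 * (norm (?y' - ?x' - ?c'))\<^sup>2
          - 1 / 2 * (norm (?z' - ?x' - ?c'))\<^sup>2 + \<alpha>\<^sup>2 / 2 * (norm (v (Suc k)))\<^sup>2)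
        - 2 * (\<phi> ?y + \<gamma> * fz (Suc k) + \<gamma> * h ?y + 1 / 2 * (norm (?y - ?x - ?c))\<^sup>2
          - 1 / 2 * (norm (?z - ?x - ?c))\<^sup>2 + \<alpha>\<^sup>2 / 2 * (norm (v k))\<^sup>2)
        \<le> (L / (L + 1) + \<gamma> * Lh - 2) * (norm (?y' - ?y))\<^sup>2 - (1 + 2 * \<alpha>) * (norm (v (Suc k)))\<^sup>2
          + 2 * (v (Suc k) \<bullet> ((1 + 2 * \<alpha>) *\<^sub>R (?y' - ?y) + ?S - \<alpha> *\<^sub>R (?c' - ?c)))
          - 2 * ((?y' - ?y) \<bullet> ?S) + (norm ?S)\<^sup>2 + 2 * (?S \<bullet> (?c' - ?c))" (is "?lhs \<le> _")
    proof (rule merit_step)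
      show "?w = ?x + \<alpha> *\<^sub>R v (Suc k)"
        by (rule w_eq)
      show "?x' = ?w + (?z' - ?y')"
        by (rule x_Suc)
      show "?y - ?z = \<alpha> *\<^sub>R v k - v (Suc k)"
        using e_Suc[of k] by (simp add: e_def)
      then show "?y - ?z = \<alpha> *\<^sub>R v (Suc k) - (?y' - ?y) - ?S"
        by (simp add: grad_\<phi>_y w_eq v_Suc)
      \<comment> \<open>The new proximal problem is tested at the old point
        \<open>?z\<close>.\<close>
      have "fz (Suc (Suc k)) + 1 / (2 * \<gamma>) * (norm (?z' - (2 *\<^sub>R ?y' - ?c' - ?w)))\<^sup>2
          \<le> fz (Suc k) + 1 / (2 * \<gamma>) * (norm (?z - (2 *\<^sub>R ?y' - ?c' - ?w)))\<^sup>2"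
        using prox_le[OF z_Suc[of "Suc k"], of ?z] by (simp add: f_z)
      from mult_left_mono[OF this, of \<gamma>]
      show "\<gamma> * fz (Suc (Suc k)) + 1 / 2 * (norm (?z' - (2 *\<^sub>R ?y' - ?c' - ?w)))\<^sup>2
          \<le> \<gamma> * fz (Suc k) + 1 / 2 * (norm (?z - (2 *\<^sub>R ?y' - ?c' - ?w)))\<^sup>2"
        using \<gamma>_pos by (simp add: distrib_left)
      \<comment> \<open>Weak convexity is based at the new point \<open>?y'\<close>, whereas the
        bound for \<open>h\<close> below is based at the old one.\<close>
      show "\<phi> ?y' + (?w - ?y') \<bullet> (?y - ?y') - L / (L + 1) / 2 * (norm (?y - ?y'))\<^sup>2 \<le> \<phi> ?y"
        using \<phi>_weakly_convex[of ?y' ?y] by (simp add: grad_\<phi>_y)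
      have "h ?y' \<le> h ?y + grad h ?y \<bullet> (?y' - ?y) + Lh / 2 * (norm (?y' - ?y))\<^sup>2"
        by (rule lipschitz_grad_upper_bound[OF GDERIV_h h_lipschitz])
      from mult_left_mono[OF this, of \<gamma>]
      show "\<gamma> * h ?y' \<le> \<gamma> * h ?y + ?c \<bullet> (?y' - ?y) + \<gamma> * Lh / 2 * (norm (?y' - ?y))\<^sup>2"
        using \<gamma>_pos by (simp add: distrib_left)
    qed
    also have "\<dots> \<le> - \<epsilon> * (norm (v (Suc k)))\<^sup>2"
      by (rule decr[OF S C])
    also have "?lhs = 2 * \<gamma> * (\<Theta> (Suc (Suc k)) - \<Theta> (Suc k))"
      using \<gamma>_pos by (simp add: \<Theta>_def G_def field_simps)
    finally have "\<Theta> (Suc (Suc k)) - \<Theta> (Suc k) \<le> - \<epsilon> * (norm (v (Suc k)))\<^sup>2 / (2 * \<gamma>)"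
      using \<gamma>_pos by (subst pos_le_divide_eq) (simp_all add: mult.commute)
    then show ?thesis
      by simp
  qed
  then show ?thesis
    using \<epsilon> \<gamma>_pos by (intro that[of "\<epsilon> / (2 * \<gamma>)"]) auto
qed

text \<open>The shift skips \<open>\<Theta> 0\<close>, which involves the unconstrained
  \<open>y 0\<close> and \<open>z 0\<close>.\<close>

lemma \<Theta>_antimono: "decseq (\<lambda>k. \<Theta> (Suc k))"
proof -
  obtain \<epsilon> where \<epsilon>: "0 < \<epsilon>" "\<And>k. \<Theta> (Suc (Suc k)) + \<epsilon> * (norm (v (Suc k)))\<^sup>2 \<le> \<Theta> (Suc k)"
    using \<Theta>_decrease by blast
  have "\<Theta> (Suc (Suc k)) \<le> \<Theta> (Suc k)" for k
  proof -
    have "0 \<le> \<epsilon> * (norm (v (Suc k)))\<^sup>2"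
      using \<epsilon>(1) by simp
    then show ?thesis
      using \<epsilon>(2)[of k] by linarith
  qed
  then show ?thesis
    by (rule decseq_SucI)
qed

section \<open>Smooth part of the objective and square-summable increments\<close>

definition s :: "'a \<Rightarrow> real" where "s u = 1 / \<gamma> * \<phi> u + h u"

definition grad_s :: "'a \<Rightarrow> 'a" where "grad_s u = (1 / \<gamma>) *\<^sub>R grad_\<phi> u + grad h u"

definition Ls :: real where "Ls = 1 / \<gamma> * (L / (1 - L)) + Lh"

lemma Ls_nonneg: "0 \<le> Ls"
  using \<gamma>_pos L_nonneg contractive Lh_nonneg by (simp add: Ls_def)

lemma GDERIV_s: "GDERIV s u :> grad_s u"
proof -
  have "((\<lambda>u. 1 / \<gamma> * \<phi> u + h u) has_derivative (\<lambda>d. 1 / \<gamma> * (d \<bullet> grad_\<phi> u) + d \<bullet> grad h u)) (at u)"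
    using GDERIV_\<phi>[of u] GDERIV_h[of u] unfolding gderiv_def
    by (intro has_derivative_add has_derivative_mult_right)
  then show ?thesis
    by (simp add: gderiv_def s_def[abs_def] grad_s_def inner_add_right)
qed

lemma lipschitz_grad_s: "Ls-lipschitz_on UNIV grad_s"
proof -
  have "(\<bar>1 / \<gamma>\<bar> * (L / (1 - L)) + Lh)-lipschitz_on UNIV (\<lambda>u. (1 / \<gamma>) *\<^sub>R grad_\<phi> u + grad h u)"
    by (intro lipschitz_on_add lipschitz_on_cmult lipschitz_grad_\<phi> h_lipschitz)
  then show ?thesis
    using \<gamma>_pos by (simp add: Ls_def grad_s_def[abs_def])
qed

lemma continuous_s: "isCont s u"
  using GDERIV_s unfolding gderiv_def by (rule has_derivative_continuous)

lemma continuous_grad_h: "isCont (grad h) u"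
  using lipschitz_on_continuous_on[OF h_lipschitz] by (simp add: continuous_on_eq_continuous_at)

lemma objective_eq: "objective \<gamma> f g h u = f u + ereal (s u)"
  by (cases "f u") (simp_all add: objective_def phi_eq s_def)

text \<open>The values decrease and are bounded below: \<open>f\<close> by assumption,
  \<open>G\<close> by continuity on the compact closure of the iterates.\<close>

lemma \<Theta>_converges: obtains c where "\<Theta> \<longlonglongrightarrow> c" "\<And>k. c \<le> \<Theta> (Suc k)"
proof -
  obtain m where m: "\<And>u. ereal m \<le> f u"
    using f_bounded_below by blast
  let ?G = "\<lambda>(p, q, r). G p q r"
  let ?K = "closure ((\<lambda>k. (y k, z k, x k)) ` {1..})"
  have "continuous_on ?K ?G"
  proof -
    have s: "continuous_on UNIV s"
      by (rule continuous_at_imp_continuous_on, rule ballI, rule continuous_s)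
    have grad_h: "continuous_on UNIV (grad h)"
      using h_lipschitz by (rule lipschitz_on_continuous_on)
    have fst: "continuous_on ?K fst"
      by (rule continuous_on_fst[OF continuous_on_id])
    have "continuous_on ?K (\<lambda>p. s (fst p))"
      by (rule continuous_on_compose2[OF s fst subset_UNIV])
    moreover have "continuous_on ?K (\<lambda>p. grad h (fst p))"
      by (rule continuous_on_compose2[OF grad_h fst subset_UNIV])
    ultimately have "continuous_on ?K (\<lambda>p. s (fst p)
        + 1 / (2 * \<gamma>) * (norm (fst p - snd (snd p) - \<gamma> *\<^sub>R grad h (fst p)))\<^sup>2
        - 1 / (2 * \<gamma>) * (norm (fst (snd p) - snd (snd p) - \<gamma> *\<^sub>R grad h (fst p)))\<^sup>2)"
      by (intro continuous_intros)
    then show ?thesis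
      by (simp add: case_prod_unfold G_def s_def)
  qed
  moreover have "compact ?K"
    using bounded_iterates by (simp add: compact_closure)
  ultimately have "bounded (?G ` ?K)"
    by (intro compact_imp_bounded compact_continuous_image)
  then obtain B where B: "\<And>p. p \<in> ?K \<Longrightarrow> norm (?G p) \<le> B"
    unfolding bounded_iff by blast
  have lower: "m - B \<le> \<Theta> (Suc k)" for k
  proof -
    have "(y (Suc k), z (Suc k), x (Suc k)) \<in> ?K"
      by (intro subsetD[OF closure_subset] imageI) simp
    from B[OF this] have "- B \<le> G (y (Suc k)) (z (Suc k)) (x (Suc k))"
      by simp
    moreover have "m \<le> fz (Suc k)"
      using m[of "z (Suc k)"] by (simp add: f_z)
    moreover have "0 \<le> \<alpha>\<^sup>2 / (2 * \<gamma>) * (norm (v (Suc k - 1)))\<^sup>2"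
      using \<gamma>_pos by simp
    ultimately show ?thesis
      unfolding \<Theta>_def by linarith
  qed
  obtain c where c: "(\<lambda>k. \<Theta> (Suc k)) \<longlonglongrightarrow> c" "\<And>k. c \<le> \<Theta> (Suc k)"
    using decseq_convergent[OF \<Theta>_antimono, of "m - B"] lower by blast
  then show ?thesis
    by (intro that[of c]) (simp_all add: filterlim_sequentially_Suc)
qed

lemma summable_v: "summable (\<lambda>k. (norm (v k))\<^sup>2)"
proof -
  obtain \<epsilon> where \<epsilon>: "0 < \<epsilon>" "\<And>k. \<Theta> (Suc (Suc k)) + \<epsilon> * (norm (v (Suc k)))\<^sup>2 \<le> \<Theta> (Suc k)"
    using \<Theta>_decrease by blast
  obtain c where c: "\<And>k. c \<le> \<Theta> (Suc k)"
    using \<Theta>_converges by blast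
  have telescope: "(\<Sum>k<n. \<epsilon> * (norm (v (Suc k)))\<^sup>2) \<le> \<Theta> 1 - \<Theta> (Suc n)" for n
  proof (induction n)
    case (Suc n)
    then show ?case
      using \<epsilon>(2)[of n] by simp
  qed simp
  have "summable (\<lambda>k. \<epsilon> * (norm (v (Suc k)))\<^sup>2)"
  proof (rule summableI_nonneg_bounded)
    show "(\<Sum>k<n. \<epsilon> * (norm (v (Suc k)))\<^sup>2) \<le> \<Theta> 1 - c" for n
      using telescope[of n] c[of n] by linarith
  qed (use \<epsilon>(1) in simp)
  then have "summable (\<lambda>k. (norm (v (Suc k)))\<^sup>2)"
    using \<epsilon>(1) by (simp add: summable_cmult_iff)
  then show ?thesis
    by (rule summable_Suc_iff[THEN iffD1])
qed

lemma summable_e: "summable (\<lambda>k. (norm (e k))\<^sup>2)"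
proof -
  have "summable (\<lambda>k. (norm (e (Suc k)))\<^sup>2)"
  proof (rule summable_comparison_test')
    show "summable (\<lambda>k. (\<alpha> * norm (v k) + 1 * norm (v (Suc k)))\<^sup>2)"
      using summable_v summable_Suc_iff[THEN iffD2, OF summable_v] by (rule summable_square_sum)
    have "norm (e (Suc k)) \<le> \<alpha> * norm (v k) + 1 * norm (v (Suc k))" for k
      using norm_triangle_ineq4[of "\<alpha> *\<^sub>R v k" "v (Suc k)"] \<alpha>_nonneg by (simp add: e_Suc)
    then show "norm ((norm (e (Suc k)))\<^sup>2) \<le> (\<alpha> * norm (v k) + 1 * norm (v (Suc k)))\<^sup>2" for k
      by (simp add: power_mono)
  qed
  then show ?thesis
    by (rule summable_Suc_iff[THEN iffD1])
qed

text \<open>The denoiser has Lipschitz constant \<open>1 + L\<close>, and increments of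
  \<open>w\<close> are combinations of \<open>v\<close>. The index is shifted twice because
  \<open>y 0\<close> does not come from the denoiser.\<close>

lemma summable_dy: "summable (\<lambda>k. (norm (y k - y (k - 1)))\<^sup>2)"
proof -
  have "summable (\<lambda>k. (norm (y (Suc (Suc k)) - y (Suc (Suc k) - 1)))\<^sup>2)"
  proof (rule summable_comparison_test')
    let ?b = "\<lambda>k. ((1 + L) * (1 + \<alpha>)) * norm (v (Suc k)) + ((1 + L) * \<alpha>) * norm (v k)"
    show "summable (\<lambda>k. (?b k)\<^sup>2)"
      using summable_Suc_iff[THEN iffD2, OF summable_v] summable_v by (rule summable_square_sum)
    have "norm (y (Suc (Suc k)) - y (Suc k)) \<le> ?b k" for k
    proof -
      have "y (Suc (Suc k)) - y (Suc k) = (w (Suc k) - w k) - (grad g (w (Suc k)) - grad g (w k))"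
        by (simp add: y_Suc denoiser_def)
      also have "norm \<dots> \<le> norm (w (Suc k) - w k) + L * norm (w (Suc k) - w k)"
        using norm_triangle_ineq4[of "w (Suc k) - w k" "grad g (w (Suc k)) - grad g (w k)"]
          norm_grad_diff_le[of "w (Suc k)" "w k"] by linarith
      also have "\<dots> = (1 + L) * norm (w (Suc k) - w k)"
        by (simp add: algebra_simps)
      finally have dy: "norm (y (Suc (Suc k)) - y (Suc k)) \<le> (1 + L) * norm (w (Suc k) - w k)" .
      have "w (Suc k) - w k = (1 + \<alpha>) *\<^sub>R v (Suc k) - \<alpha> *\<^sub>R v k"
        by (simp add: w_eq v_Suc algebra_simps)
      then have "norm (w (Suc k) - w k) \<le> (1 + \<alpha>) * norm (v (Suc k)) + \<alpha> * norm (v k)"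
        using norm_triangle_ineq4[of "(1 + \<alpha>) *\<^sub>R v (Suc k)" "\<alpha> *\<^sub>R v k"] \<alpha>_nonneg by simp
      then have "(1 + L) * norm (w (Suc k) - w k)
          \<le> (1 + L) * ((1 + \<alpha>) * norm (v (Suc k)) + \<alpha> * norm (v k))"
        using L_nonneg by (intro mult_left_mono) auto
      with dy show ?thesis
        by (simp add: algebra_simps)
    qed
    then show "norm ((norm (y (Suc (Suc k)) - y (Suc (Suc k) - 1)))\<^sup>2) \<le> (?b k)\<^sup>2" for k
      by (simp add: power_mono)
  qed
  then show ?thesis
    by (intro summable_Suc_iff[THEN iffD1, of "\<lambda>k. (norm (y k - y (k - 1)))\<^sup>2"]
        summable_Suc_iff[THEN iffD1, of "\<lambda>k. (norm (y (Suc k) - y (Suc k - 1)))\<^sup>2"])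
qed

lemma v_tendsto: "v \<longlonglongrightarrow> 0"
  using summable_v by (rule tendsto_zero_if_square_summable)

lemma e_tendsto: "e \<longlonglongrightarrow> 0"
  using summable_e by (rule tendsto_zero_if_square_summable)

end

section \<open>Subgradients of the objective and its distance to the merit values\<close>

context extrapolated_dys
begin

abbreviation (input) F where "F \<equiv> objective \<gamma> f g h"

lemma \<alpha>_le_1: "\<alpha> \<le> 1"
proof -
  have "0 \<le> (\<gamma> * Lh) * (\<alpha> + (L / (1 - L))\<^sup>2)" "0 \<le> L / (L + 1)" "0 \<le> \<gamma> * Lh" "0 \<le> (L / (1 - L))\<^sup>2"
    using \<alpha>_nonneg \<gamma>_pos Lh_nonneg L_nonneg by auto
  then show ?thesis
    using \<alpha>_bound unfolding distrib_left distrib_right by linarith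
qed

text \<open>The common error scale at iterate \<open>Suc k\<close>: it controls both the gap
  \<open>e (Suc k)\<close> and the extrapolation term \<open>v k\<close>.\<close>

definition \<delta> where "\<delta> k = norm (v (Suc k)) + norm (v k)"

lemma \<delta>_nonneg: "0 \<le> \<delta> k"
  by (simp add: \<delta>_def)

lemma \<delta>_tendsto: "\<delta> \<longlonglongrightarrow> 0"
  using tendsto_add[OF tendsto_norm[OF v_tendsto[THEN filterlim_sequentially_Suc[THEN iffD2]]]
      tendsto_norm[OF v_tendsto]]
  by (simp add: \<delta>_def[abs_def])

lemma norm_e_le: "norm (e (Suc k)) \<le> \<delta> k"
proof -
  have "norm (e (Suc k)) \<le> \<alpha> * norm (v k) + norm (v (Suc k))"
    using norm_triangle_ineq4[of "\<alpha> *\<^sub>R v k" "v (Suc k)"] \<alpha>_nonneg by (simp add: e_Suc)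
  also have "\<alpha> * norm (v k) \<le> 1 * norm (v k)"
    using \<alpha>_le_1 by (intro mult_right_mono) auto
  finally show ?thesis
    by (simp add: \<delta>_def)
qed

text \<open>For positive \<open>k\<close>, optimality of \<open>z k\<close> makes the first two
  terms a subgradient of \<open>f\<close> there; adding \<open>grad_s (z k)\<close> yields one of
  the objective.\<close>

definition subgrad where "subgrad k = (1 / \<gamma>) *\<^sub>R e k - grad_s (y k) + grad_s (z k)"

lemma subgrad_in_frechet: "subgrad (Suc k) \<in> frechet_subdiff F (z (Suc k))"
proof (rule frechet_subdiffI)
  let ?y = "y (Suc k)" and ?z = "z (Suc k)" and ?c = "1 / (2 * \<gamma>) + Ls / 2"
  show "\<bar>F ?z\<bar> \<noteq> \<infinity>"
    by (simp add: objective_eq f_z)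
  fix q
  let ?p = "2 *\<^sub>R ?y - \<gamma> *\<^sub>R grad h ?y - w k"
  have p: "(1 / \<gamma>) *\<^sub>R (?p - ?z) = (1 / \<gamma>) *\<^sub>R e (Suc k) - grad_s ?y"
  proof -
    have "?p - ?z = e (Suc k) - grad_\<phi> ?y - \<gamma> *\<^sub>R grad h ?y"
      by (simp add: e_def grad_\<phi>_y scaleR_2)
    then have "(1 / \<gamma>) *\<^sub>R (?p - ?z) = (1 / \<gamma>) *\<^sub>R (e (Suc k) - grad_\<phi> ?y - \<gamma> *\<^sub>R grad h ?y)"
      by (rule arg_cong)
    also have "\<dots> = (1 / \<gamma>) *\<^sub>R e (Suc k) - grad_s ?y"
      using \<gamma>_pos by (simp add: grad_s_def scaleR_diff_right)
    finally show ?thesis .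
  qed
  define A where "A = ((1 / \<gamma>) *\<^sub>R e (Suc k) - grad_s ?y) \<bullet> (q - ?z) - 1 / (2 * \<gamma>) * (norm (q - ?z))\<^sup>2"
  define B where "B = grad_s ?z \<bullet> (q - ?z) - Ls / 2 * (norm (q - ?z))\<^sup>2"
  have "subgrad (Suc k) \<bullet> (q - ?z) - ?c * (norm (q - ?z))\<^sup>2 = A + B"
    unfolding A_def B_def subgrad_def inner_add_left distrib_right by simp
  then have "F ?z + ereal (subgrad (Suc k) \<bullet> (q - ?z) - ?c * (norm (q - ?z))\<^sup>2)
      = (f ?z + ereal A) + ereal (s ?z + B)"
    by (simp add: objective_eq f_z)
  also have "\<dots> \<le> f q + ereal (s q)"
  proof (rule add_mono)
    show "f ?z + ereal A \<le> f q"
      using prox_lower_quadratic[OF z_Suc, of k q] unfolding p A_def .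
    show "ereal (s ?z + B) \<le> ereal (s q)"
      using lipschitz_grad_lower_bound[OF GDERIV_s lipschitz_grad_s, of ?z q] by (simp add: B_def)
  qed
  finally show "F ?z + ereal (subgrad (Suc k) \<bullet> (q - ?z) - ?c * (norm (q - ?z))\<^sup>2) \<le> F q"
    by (simp add: objective_eq)
qed

lemma norm_subgrad_le: "norm (subgrad k) \<le> (1 / \<gamma> + Ls) * norm (e k)"
proof -
  have "norm (subgrad k) \<le> norm ((1 / \<gamma>) *\<^sub>R e k) + norm (grad_s (y k) - grad_s (z k))"
    unfolding subgrad_def
    using norm_triangle_ineq4[of "(1 / \<gamma>) *\<^sub>R e k" "grad_s (y k) - grad_s (z k)"]
    by (simp add: algebra_simps)
  moreover have "norm (grad_s (y k) - grad_s (z k)) \<le> Ls * norm (e k)"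
    using lipschitz_on_normD[OF lipschitz_grad_s, of "y k" "z k"] by (simp add: e_def)
  ultimately show ?thesis
    using \<gamma>_pos by (simp add: distrib_right)
qed

text \<open>As \<open>z - y = - e\<close>, the first two terms are the linearisation of
  \<open>s\<close> at \<open>y\<close> evaluated at \<open>z\<close>. So the merit value is a
  first-order model of the objective at \<open>z\<close>.\<close>

lemma G_eq:
  "G (y (Suc k)) (z (Suc k)) (x (Suc k))
    = s (y (Suc k)) - grad_s (y (Suc k)) \<bullet> e (Suc k) + 1 / (2 * \<gamma>) * (norm (e (Suc k)))\<^sup>2"
proof -
  let ?y = "y (Suc k)" and ?z = "z (Suc k)" and ?x = "x (Suc k)" and ?e = "e (Suc k)"
  have grad: "\<gamma> *\<^sub>R grad_s ?y = grad_\<phi> ?y + \<gamma> *\<^sub>R grad h ?y"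
    using \<gamma>_pos by (simp add: grad_s_def scaleR_add_right)
  have 1: "?y - ?x - \<gamma> *\<^sub>R grad h ?y = ?e - \<gamma> *\<^sub>R grad_s ?y"
    and 2: "?z - ?x - \<gamma> *\<^sub>R grad h ?y = - (\<gamma> *\<^sub>R grad_s ?y)"
    unfolding grad by (simp_all add: e_def x_Suc grad_\<phi>_y)
  have "(norm (p - q))\<^sup>2 = (norm p)\<^sup>2 - 2 * (q \<bullet> p) + (norm q)\<^sup>2" for p q :: 'a
    by (simp add: power2_norm_eq_inner inner_diff_left inner_diff_right inner_commute)
  from arg_cong[OF this[of ?e "\<gamma> *\<^sub>R grad_s ?y"], of "\<lambda>t. 1 / (2 * \<gamma>) * t"]
  have "1 / (2 * \<gamma>) * (norm (?e - \<gamma> *\<^sub>R grad_s ?y))\<^sup>2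
      = 1 / (2 * \<gamma>) * (norm ?e)\<^sup>2 - grad_s ?y \<bullet> ?e + 1 / (2 * \<gamma>) * (norm (\<gamma> *\<^sub>R grad_s ?y))\<^sup>2"
    using \<gamma>_pos by (simp add: distrib_left right_diff_distrib)
  then show ?thesis
    unfolding G_def 1 2 norm_minus_cancel by (simp add: s_def)
qed

definition b where "b k = fz (Suc k) + s (z (Suc k))"

lemma objective_z: "F (z (Suc k)) = ereal (b k)"
  by (simp add: objective_eq f_z b_def)

text \<open>The summands pay for the Taylor remainder of \<open>s\<close>, the squared gap and the
  extrapolation term, in this order.\<close>

definition K where "K = Ls / 2 + 1 / (2 * \<gamma>) + \<alpha>\<^sup>2 / (2 * \<gamma>)"

lemma K_nonneg: "0 \<le> K"
  using Ls_nonneg \<gamma>_pos by (simp add: K_def)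

lemma merit_gap: "\<bar>\<Theta> (Suc k) - b k\<bar> \<le> K * (\<delta> k)\<^sup>2"
proof -
  let ?y = "y (Suc k)" and ?z = "z (Suc k)" and ?e = "e (Suc k)"
  define r where "r = s ?y - s ?z - grad_s ?y \<bullet> ?e"
  have zy: "?z - ?y = - ?e"
    by (simp add: e_def)
  have "s ?z \<le> s ?y - grad_s ?y \<bullet> ?e + Ls / 2 * (norm ?e)\<^sup>2"
    using lipschitz_grad_upper_bound[OF GDERIV_s lipschitz_grad_s, of ?z ?y] by (simp add: zy)
  moreover have "s ?y - grad_s ?y \<bullet> ?e - Ls / 2 * (norm ?e)\<^sup>2 \<le> s ?z"
    using lipschitz_grad_lower_bound[OF GDERIV_s lipschitz_grad_s, of ?y ?z] by (simp add: zy)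
  ultimately have "\<bar>r\<bar> \<le> Ls / 2 * (norm ?e)\<^sup>2"
    unfolding r_def abs_le_iff by linarith
  also have "\<dots> \<le> Ls / 2 * (\<delta> k)\<^sup>2"
    using norm_e_le Ls_nonneg by (intro mult_left_mono power_mono) auto
  finally have r: "\<bar>r\<bar> \<le> Ls / 2 * (\<delta> k)\<^sup>2" .
  have "1 / (2 * \<gamma>) * (norm ?e)\<^sup>2 \<le> 1 / (2 * \<gamma>) * (\<delta> k)\<^sup>2"
    using norm_e_le \<gamma>_pos by (intro mult_left_mono power_mono) auto
  moreover have "\<alpha>\<^sup>2 / (2 * \<gamma>) * (norm (v k))\<^sup>2 \<le> \<alpha>\<^sup>2 / (2 * \<gamma>) * (\<delta> k)\<^sup>2"
    using \<gamma>_pos by (intro mult_left_mono power_mono) (auto simp: \<delta>_def)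
  moreover have "\<Theta> (Suc k) - b k
      = r + 1 / (2 * \<gamma>) * (norm ?e)\<^sup>2 + \<alpha>\<^sup>2 / (2 * \<gamma>) * (norm (v k))\<^sup>2"
    by (simp add: \<Theta>_def G_eq b_def r_def)
  moreover have "0 \<le> 1 / (2 * \<gamma>) * (norm ?e)\<^sup>2" "0 \<le> \<alpha>\<^sup>2 / (2 * \<gamma>) * (norm (v k))\<^sup>2"
    using \<gamma>_pos by auto
  ultimately show ?thesis
    using r unfolding K_def distrib_right by linarith
qed

lemma b_tendsto:
  assumes "\<Theta> \<longlonglongrightarrow> c"
  shows "b \<longlonglongrightarrow> c"
proof -
  have null: "(\<lambda>k. K * (\<delta> k)\<^sup>2) \<longlonglongrightarrow> K * 0\<^sup>2"
    by (intro tendsto_mult tendsto_const tendsto_power \<delta>_tendsto)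
  have "(\<lambda>k. \<Theta> (Suc k) - b k) \<longlonglongrightarrow> 0"
  proof (rule Lim_null_comparison)
    show "\<forall>\<^sub>F k in sequentially. norm (\<Theta> (Suc k) - b k) \<le> K * (\<delta> k)\<^sup>2"
      by (simp add: merit_gap)
    show "(\<lambda>k. K * (\<delta> k)\<^sup>2) \<longlonglongrightarrow> 0"
      using null by simp
  qed
  from tendsto_diff[OF assms[THEN filterlim_sequentially_Suc[THEN iffD2]] this] show ?thesis
    by simp
qed

section \<open>Cluster points of the iterates\<close>

context
  fixes n :: "nat \<Rightarrow> nat" and ys zs xs :: 'a
  assumes n: "filterlim n sequentially sequentially"
    and lim_y: "(\<lambda>j. y (Suc (n j))) \<longlonglongrightarrow> ys"
    and lim_z: "(\<lambda>j. z (Suc (n j))) \<longlonglongrightarrow> zs"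
    and lim_x: "(\<lambda>j. x (Suc (n j))) \<longlonglongrightarrow> xs"
begin

lemma lim_e: "(\<lambda>j. e (Suc (n j))) \<longlonglongrightarrow> 0"
  using filterlim_compose[OF e_tendsto[THEN filterlim_sequentially_Suc[THEN iffD2]] n] .

lemma cluster_y_eq_z: "ys = zs"
proof -
  have "(\<lambda>j. e (Suc (n j))) \<longlonglongrightarrow> ys - zs"
    unfolding e_def by (intro tendsto_diff lim_y lim_z)
  from LIMSEQ_unique[OF this lim_e] show ?thesis
    by simp
qed

text \<open>\<open>w\<close> differs from the next \<open>x\<close> by the vanishing gap, so
  \<open>grad g (w (n j))\<close> tends to \<open>grad g xs\<close>. The formula later keeps
  \<open>z\<close> near \<open>zs\<close> while \<open>x\<close> is near \<open>xs\<close>.\<close>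

lemma cluster_z_eq: "zs = xs - grad g xs"
proof -
  have w: "w (n j) = x (Suc (n j)) + e (Suc (n j))" for j
    by (simp add: x_Suc e_def)
  have "z (Suc (n j)) = x (Suc (n j)) - grad g (w (n j))" for j
    by (simp add: x_Suc y_Suc denoiser_def)
  then have "(\<lambda>j. x (Suc (n j)) - grad g (w (n j))) \<longlonglongrightarrow> zs"
    using lim_z by simp
  moreover have "(\<lambda>j. x (Suc (n j)) - grad g (w (n j))) \<longlonglongrightarrow> xs - grad g xs"
  proof (rule tendsto_diff[OF lim_x], rule isCont_tendsto_compose[of xs "grad g"])
    show "isCont (grad g) xs"
      using lipschitz_on_continuous_on[OF lipschitz] by (simp add: continuous_on_eq_continuous_at)
    show "(\<lambda>j. w (n j)) \<longlonglongrightarrow> xs"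
      unfolding w using tendsto_add[OF lim_x lim_e] by simp
  qed
  ultimately show ?thesis
    by (rule LIMSEQ_unique)
qed

text \<open>The lower bound is semicontinuity. For the upper one the proximal problems are tested at
  the fixed point \<open>zs\<close>; the quadratic terms then differ by \<open>q j\<close>, which
  tends to 0.\<close>

lemma lim_f_z: "(\<lambda>j. f (z (Suc (n j)))) \<longlonglongrightarrow> f zs"
proof (rule order_tendstoI)
  fix a assume "a < f zs"
  then show "\<forall>\<^sub>F j in sequentially. a < f (z (Suc (n j)))"
    using lsc_less_eventually[OF lsc] lim_z by (auto dest: eventually_compose_filterlim)
next
  fix a assume a: "f zs < a"
  define p where "p j = 2 *\<^sub>R y (Suc (n j)) - \<gamma> *\<^sub>R grad h (y (Suc (n j))) - w (n j)" for j
  define q where "q j = 1 / (2 * \<gamma>) * ((norm (zs - p j))\<^sup>2 - (norm (z (Suc (n j)) - p j))\<^sup>2)" for j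
  have w: "w (n j) = x (Suc (n j)) + e (Suc (n j))" for j
    by (simp add: x_Suc e_def)
  have p: "p \<longlonglongrightarrow> 2 *\<^sub>R ys - \<gamma> *\<^sub>R grad h ys - (xs + 0)"
    unfolding p_def w
    by (intro tendsto_diff tendsto_add tendsto_scaleR tendsto_const lim_y lim_x lim_e
        isCont_tendsto_compose[OF continuous_grad_h])
  let ?p = "2 *\<^sub>R ys - \<gamma> *\<^sub>R grad h ys - (xs + 0)"
  have "q \<longlonglongrightarrow> 1 / (2 * \<gamma>) * ((norm (zs - ?p))\<^sup>2 - (norm (zs - ?p))\<^sup>2)"
    unfolding q_def by (intro tendsto_mult tendsto_const tendsto_diff tendsto_power tendsto_norm p lim_z)
  then have "q \<longlonglongrightarrow> 0"
    by simp
  then have "(\<lambda>j. f zs + ereal (q j)) \<longlonglongrightarrow> f zs + ereal 0"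
    by (intro tendsto_add_ereal_general1 tendsto_const tendsto_ereal) simp_all
  then have "\<forall>\<^sub>F j in sequentially. f zs + ereal (q j) < a"
    using a by (intro order_tendstoD(2)) (auto simp flip: zero_ereal_def)
  then show "\<forall>\<^sub>F j in sequentially. f (z (Suc (n j))) < a"
  proof eventually_elim
    case (elim j)
    have "f (z (Suc (n j))) \<le> f zs + ereal (q j)"
      using prox_le[OF z_Suc[of "n j"], of zs] unfolding p_def[symmetric] f_z q_def
      by (cases "f zs") (simp_all add: right_diff_distrib)
    with elim show ?case
      by simp
  qed
qed

lemma lim_objective: "(\<lambda>j. F (z (Suc (n j)))) \<longlonglongrightarrow> F zs"
  unfolding objective_eq
  by (intro tendsto_add_ereal_general1 lim_f_z tendsto_ereal isCont_tendsto_compose[OF continuous_s lim_z]) simp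

text \<open>The subgradients at \<open>z\<close> are bounded by the vanishing gap, and the objective
  values converge along the same subsequence.\<close>

lemma cluster_critical: "0 \<in> limiting_subdiff F zs"
proof -
  have null: "(\<lambda>j. (1 / \<gamma> + Ls) * norm (e (Suc (n j)))) \<longlonglongrightarrow> (1 / \<gamma> + Ls) * norm (0 :: 'a)"
    by (intro tendsto_mult tendsto_const tendsto_norm lim_e)
  have "(\<lambda>j. subgrad (Suc (n j))) \<longlonglongrightarrow> 0"
  proof (rule Lim_null_comparison)
    show "\<forall>\<^sub>F j in sequentially. norm (subgrad (Suc (n j))) \<le> (1 / \<gamma> + Ls) * norm (e (Suc (n j)))"
      by (simp add: norm_subgrad_le)
    show "(\<lambda>j. (1 / \<gamma> + Ls) * norm (e (Suc (n j)))) \<longlonglongrightarrow> 0"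
      using null by simp
  qed
  then show ?thesis
    unfolding limiting_subdiff_def
    by (intro CollectI exI[where x = "\<lambda>j. z (Suc (n j))"] exI[where x = "\<lambda>j. subgrad (Suc (n j))"]
        conjI allI lim_z lim_objective subgrad_in_frechet)
qed

end

section \<open>Convergence of the whole sequence under the KL property\<close>

text \<open>The descent of \<Theta> combined with the inexact KL inequality at a cluster point gives
  the recursion required by \<open>cluster_point_trapping\<close>.\<close>

lemma convergent_x:
  assumes KL: "KL_function F"
  shows "convergent x"
proof -
  obtain c where \<Theta>_lim: "\<Theta> \<longlonglongrightarrow> c" and c_le: "\<And>k. c \<le> \<Theta> (Suc k)"
    using \<Theta>_converges by blast
  obtain \<epsilon> where \<epsilon>: "0 < \<epsilon>" "\<And>k. \<Theta> (Suc (Suc k)) + \<epsilon> * (norm (v (Suc k)))\<^sup>2 \<le> \<Theta> (Suc k)"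
    using \<Theta>_decrease by blast
  have "bounded (range (\<lambda>k. (y (Suc k), z (Suc k), x (Suc k))))"
    using bounded_iterates by (rule bounded_subset) auto
  then obtain l r where r: "strict_mono r"
    and l: "((\<lambda>k. (y (Suc k), z (Suc k), x (Suc k))) \<circ> r) \<longlonglongrightarrow> l"
    using bounded_imp_convergent_subsequence by metis
  define ys zs xs where "ys = fst l" and "zs = fst (snd l)" and "xs = snd (snd l)"
  note lims = filterlim_subseq[OF r]
    tendsto_fst[OF l, unfolded o_def, simplified, folded ys_def]
    tendsto_fst[OF tendsto_snd[OF l], unfolded o_def, simplified, folded zs_def]
    tendsto_snd[OF tendsto_snd[OF l], unfolded o_def, simplified, folded xs_def]
  have "(\<lambda>j. ereal (b (r j))) \<longlonglongrightarrow> ereal c"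
    using filterlim_compose[OF b_tendsto[OF \<Theta>_lim] lims(1)] by simp
  \<comment> \<open>The merit limit is the objective value at \<open>zs\<close>, so the KL
    inequality refers to the same level \<open>c\<close>.\<close>
  then have F_zs: "F zs = ereal c"
    using lim_objective[OF lims] unfolding objective_z by (rule LIMSEQ_unique[symmetric])
  have KL_zs: "KL_at F zs"
    using KL cluster_critical[OF lims] unfolding KL_function_def by blast
  define K' where "K' = max K (1 / \<gamma> + Ls)"
  have K': "0 \<le> K'" "K \<le> K'" "1 / \<gamma> + Ls \<le> K'"
    using K_nonneg by (auto simp: K'_def)
  show ?thesis
  proof (rule KL_at_inexact[where F = F and a = zs and c = c, OF KL_zs F_zs K'(1)])
    fix \<eta> U \<psi> M
    assume \<eta>: "0 < \<eta>" and U: "open U" "zs \<in> U"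
      and \<psi>: "(\<psi> \<longlongrightarrow> (0::real)) (at_right 0)" "\<psi> 0 = 0" and M: "0 \<le> M"
      and \<psi>_mono: "\<And>s t. 0 \<le> s \<Longrightarrow> s \<le> t \<Longrightarrow> t < \<eta> \<Longrightarrow> \<psi> s \<le> \<psi> t"
      and KL_le: "\<And>p b u s t \<delta>. p \<in> U \<Longrightarrow> F p = ereal b \<Longrightarrow> b - c < \<eta> \<Longrightarrow> u \<in> limiting_subdiff F p \<Longrightarrow>
        0 \<le> s \<Longrightarrow> s \<le> t \<Longrightarrow> 0 < t \<Longrightarrow> t < \<eta> \<Longrightarrow> 0 \<le> \<delta> \<Longrightarrow> t - K' * \<delta>\<^sup>2 \<le> b - c \<Longrightarrow>
        norm u \<le> K' * \<delta> \<Longrightarrow> t - s \<le> M * \<delta> * (\<psi> t - \<psi> s)"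
    obtain \<rho> where \<rho>: "0 < \<rho>" "ball zs \<rho> \<subseteq> U"
      using U openE by blast
    define D where "D k = \<psi> (\<Theta> k - c)" for k
    have "\<forall>\<^sub>F k in sequentially. \<delta> k < \<rho> / 2"
      using order_tendstoD(2)[OF \<delta>_tendsto, of "\<rho> / 2"] \<rho> by simp
    moreover have "\<forall>\<^sub>F k in sequentially. b k < c + \<eta>"
      using order_tendstoD(2)[OF b_tendsto[OF \<Theta>_lim], of "c + \<eta>"] \<eta> by simp
    moreover have "\<forall>\<^sub>F k in sequentially. \<Theta> (Suc k) < c + \<eta>"
      using order_tendstoD(2)[OF \<Theta>_lim[THEN filterlim_sequentially_Suc[THEN iffD2]], of "c + \<eta>"] \<eta> by simp
    ultimately have "\<forall>\<^sub>F k in sequentially. \<delta> k < \<rho> / 2 \<and> b k < c + \<eta> \<and> \<Theta> (Suc k) < c + \<eta>"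
      by eventually_elim simp
    then obtain i\<^sub>0 where i\<^sub>0: "\<And>i. i\<^sub>0 \<le> i \<Longrightarrow> \<delta> i < \<rho> / 2"
      "\<And>i. i\<^sub>0 \<le> i \<Longrightarrow> b i < c + \<eta>" "\<And>i. i\<^sub>0 \<le> i \<Longrightarrow> \<Theta> (Suc i) < c + \<eta>"
      unfolding eventually_sequentially by blast
    have antimono: "\<Theta> (Suc (Suc i)) \<le> \<Theta> (Suc i)" for i
      using decseq_SucD[OF \<Theta>_antimono] .
    have Suc_ge: "\<exists>i. k = Suc i \<and> i\<^sub>0 \<le> i" if "Suc i\<^sub>0 \<le> k" for k
      using that by (cases k) auto
    show ?thesis
    proof (rule cluster_point_trapping[where D = D and M = "M / \<epsilon>" and \<rho> = "\<rho> / 4" and k\<^sub>0 = "Suc i\<^sub>0"])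
      show "strict_mono (Suc \<circ> r)"
        using r by (simp add: strict_mono_def)
      show "(x \<circ> (Suc \<circ> r)) \<longlonglongrightarrow> xs"
        using lims(4) by (simp add: o_def)
      show "(\<lambda>k. x k - x (k - 1)) \<longlonglongrightarrow> 0"
        using v_tendsto by (simp add: v_def[abs_def])
      show "0 < \<rho> / 4" "0 \<le> M / \<epsilon>"
        using \<rho> M \<epsilon> by auto
      \<comment> \<open>The excess over \<open>c\<close> may be exactly 0, so the right-hand limit
        is combined with \<open>\<psi> 0 = 0\<close>.\<close>
      have "continuous (at 0 within {0..}) \<psi>"
        using \<psi> by (simp add: continuous_within at_within_Ici_at_right)
      then have "(\<lambda>k. \<psi> (\<Theta> (Suc k) - c)) \<longlonglongrightarrow> \<psi> 0"
      proof (rule continuous_within_tendsto_compose')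
        show "\<Theta> (Suc k) - c \<in> {0..}" for k
          using c_le by simp
        have "(\<lambda>k. \<Theta> (Suc k) - c) \<longlonglongrightarrow> c - c"
          using \<Theta>_lim by (intro tendsto_diff tendsto_const) (simp add: filterlim_sequentially_Suc)
        then show "(\<lambda>k. \<Theta> (Suc k) - c) \<longlonglongrightarrow> 0"
          by simp
      qed
      then have "(\<lambda>k. D (Suc k)) \<longlonglongrightarrow> 0"
        by (simp add: D_def \<psi>(2))
      then show "D \<longlonglongrightarrow> 0"
        by (rule filterlim_sequentially_Suc[THEN iffD1])
      show "0 \<le> D k" if k: "Suc i\<^sub>0 \<le> k" for k
      proof -
        obtain i where "k = Suc i" "i\<^sub>0 \<le> i"
          using Suc_ge[OF k] by blast
        then show ?thesis
          using \<psi>_mono[of 0 "\<Theta> k - c"] c_le[of i] i\<^sub>0(3)[of i] \<psi>(2) by (simp add: D_def)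
      qed
      show "D (Suc k) \<le> D k" if k: "Suc i\<^sub>0 \<le> k" for k
      proof -
        obtain i where "k = Suc i" "i\<^sub>0 \<le> i"
          using Suc_ge[OF k] by blast
        then show ?thesis
          unfolding D_def using c_le[of "Suc i"] antimono[of i] i\<^sub>0(3)[of i] by (intro \<psi>_mono) auto
      qed
      fix k assume k: "Suc i\<^sub>0 \<le> k" and near: "dist (x k) xs < \<rho> / 4"
      obtain i where i: "k = Suc i" "i\<^sub>0 \<le> i"
        using Suc_ge[OF k] by blast
      \<comment> \<open>The distance to \<open>zs\<close> is at most
        \<open>2 * norm (x k - xs) + norm (e k)\<close>, and each summand is below
        \<open>\<rho> / 2\<close>.\<close>
      have "z k \<in> U"
      proof (rule subsetD[OF \<rho>(2)])
        have w: "w i = x k + e k"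
          by (simp add: i x_Suc e_def)
        have "z k - zs = (x k - xs) - (grad g (w i) - grad g xs)"
          unfolding cluster_z_eq[OF lims] by (simp add: i x_Suc y_Suc denoiser_def)
        then have "norm (z k - zs) \<le> norm (x k - xs) + norm (grad g (w i) - grad g xs)"
          using norm_triangle_ineq4[of "x k - xs" "grad g (w i) - grad g xs"] by simp
        also have "norm (grad g (w i) - grad g xs) \<le> 1 * norm (w i - xs)"
          using norm_grad_diff_le[of "w i" xs] contractive mult_right_mono[of L 1 "norm (w i - xs)"] by simp
        also have "norm (w i - xs) \<le> norm (x k - xs) + norm (e k)"
          using norm_triangle_ineq[of "x k - xs" "e k"] unfolding w by (simp add: algebra_simps)
        finally show "z k \<in> ball zs \<rho>"
          using near norm_e_le[of i] i\<^sub>0(1)[OF i(2)] by (simp add: i dist_norm norm_minus_commute)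
      qed
      have v_le: "\<epsilon> * (norm (v k))\<^sup>2 \<le> (\<Theta> k - c) - (\<Theta> (Suc k) - c)"
        using \<epsilon>(2)[of i] by (simp add: i)
      also have "\<dots> \<le> M * \<delta> i * (D k - D (Suc k))"
      \<comment> \<open>The KL estimate needs a positive excess; at level \<open>c\<close> both
        sides vanish.\<close>
      proof (cases "\<Theta> k = c")
        case True
        then have "\<Theta> (Suc k) = c"
          using antimono[of i] c_le[of "Suc i"] by (simp add: i)
        with True show ?thesis
          by (simp add: D_def)
      next
        case False
        show ?thesis
          unfolding D_def
        proof (rule KL_le)
          show "z k \<in> U" by fact
          show "F (z k) = ereal (b i)"
            by (simp add: i objective_z)
          show "subgrad k \<in> limiting_subdiff F (z k)"
            unfolding i by (rule subsetD[OF frechet_subdiff_subset_limiting subgrad_in_frechet])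
          show "0 < \<Theta> k - c"
            using False c_le[of i] by (simp add: i)
          have "K * (\<delta> i)\<^sup>2 \<le> K' * (\<delta> i)\<^sup>2"
            using K' by (intro mult_right_mono) auto
          then show "\<Theta> k - c - K' * (\<delta> i)\<^sup>2 \<le> b i - c"
            using merit_gap[of i] by (simp add: i)
          have "norm (subgrad k) \<le> (1 / \<gamma> + Ls) * norm (e k)"
            by (rule norm_subgrad_le)
          also have "\<dots> \<le> K' * \<delta> i"
            unfolding i using K' norm_e_le by (intro mult_mono) auto
          finally show "norm (subgrad k) \<le> K' * \<delta> i" .
        qed (use i i\<^sub>0(2,3)[OF i(2)] c_le[of "Suc i"] antimono[of i] \<delta>_nonneg in auto)
      qed
      finally have "(norm (v k))\<^sup>2 \<le> M * \<delta> i * (D k - D (Suc k)) / \<epsilon>"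
        using \<epsilon>(1) by (simp add: pos_le_divide_eq mult.commute)
      then show "(norm (x k - x (k - 1)))\<^sup>2
          \<le> M / \<epsilon> * (D k - D (Suc k)) * (norm (x k - x (k - 1)) + norm (x (k - 1) - x (k - 2)))"
      proof -
        have "k - 2 = k - 1 - 1"
          by simp
        moreover have "\<delta> i = norm (v k) + norm (v (k - 1))"
          by (simp add: \<delta>_def i)
        ultimately show ?thesis
          using \<open>(norm (v k))\<^sup>2 \<le> _\<close> unfolding v_def by (simp add: mult_ac)
      qed
    qed
  qed
qed

text \<open>As \<open>v\<close> and \<open>e\<close> vanish, \<open>w\<close> shares the limit of
  \<open>x\<close>, and \<open>z\<close> that of \<open>y\<close>, which continuity of
  \<open>grad g\<close> supplies.\<close>

lemma convergent_iterate:
  assumes "convergent x"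
  shows "convergent (iterate y z x)"
proof -
  obtain xs where x: "x \<longlonglongrightarrow> xs"
    using assms by (auto simp: convergent_def)
  have Suc_lim: "(\<lambda>k. a (Suc k)) \<longlonglongrightarrow> l \<longleftrightarrow> a \<longlonglongrightarrow> l" for a :: "nat \<Rightarrow> 'a" and l
    by (rule filterlim_sequentially_Suc)
  have x1: "(\<lambda>k. x (k - 1)) \<longlonglongrightarrow> xs"
    using x Suc_lim[of "\<lambda>k. x (k - 1)"] by simp
  have x2: "(\<lambda>k. x (k - 2)) \<longlonglongrightarrow> xs"
    using x1 Suc_lim[of "\<lambda>k. x (k - 2)" xs] by simp
  have "w = (\<lambda>k. x k + \<alpha> *\<^sub>R v k)"
    using w_eq by blast
  then have w: "w \<longlonglongrightarrow> xs"
    using tendsto_add[OF x tendsto_scaleR[OF tendsto_const v_tendsto], of \<alpha>] by simp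
  have "isCont (grad g) xs"
    using lipschitz_on_continuous_on[OF lipschitz] by (simp add: continuous_on_eq_continuous_at)
  then have "(\<lambda>k. w k - grad g (w k)) \<longlonglongrightarrow> xs - grad g xs"
    using w by (intro tendsto_diff isCont_tendsto_compose[of xs "grad g"])
  then have "y \<longlonglongrightarrow> xs - grad g xs"
    using Suc_lim[of y] by (simp add: y_Suc denoiser_def)
  moreover from tendsto_diff[OF this e_tendsto] have "z \<longlonglongrightarrow> xs - grad g xs"
    by (simp add: e_def)
  ultimately have "iterate y z x \<longlonglongrightarrow> (xs - grad g xs, xs - grad g xs, xs, xs, xs)"
    unfolding iterate_def[abs_def] by (intro tendsto_Pair x x1 x2)
  then show ?thesis
    by (rule convergentI)
qed

end

section \<open>Assembly of the four assertions from the locale results\<close>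

theorem theorem4p3:
  fixes f :: "'a::euclidean_space \<Rightarrow> ereal" and g h :: "'a \<Rightarrow> real"
    and w x y z :: "nat \<Rightarrow> 'a"
    and L Lh Lf1 l \<alpha> \<gamma> :: real
  assumes g: "C2 g" "L-lipschitz_on UNIV (grad g)" "L < 1"
    and convex_range: "convex (range (denoiser g))"
    and f: "proper_fun f" "lsc f"
    and h: "\<And>v. h differentiable (at v)" "Lh-lipschitz_on UNIV (grad h)"
    and bounded_below: "\<exists>m::real. \<forall>v. ereal m \<le> f v" "bdd_below (range g)" "bdd_below (range h)"
    and Lf1: "Lf1 = L / (\<gamma> * (1 - L))"
    and l: "l = L / (\<gamma> * (L + 1))"
    and \<gamma>: "0 < \<gamma>" "ereal \<gamma> < 1 / ereal (Lf1 + Lh)"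
    and \<alpha>: "0 \<le> \<alpha>" "\<alpha> < (1 - \<gamma> * l - 2 * \<gamma> * Lh) / (2 + \<gamma> * Lh) - \<gamma>\<^sup>2 * Lf1\<^sup>2"
    and iteration: "pnp_dys \<alpha> \<gamma> f g h w y z x"
    and bounded_iterates: "bounded ((\<lambda>k. (y k, z k, x k)) ` {1..})"
  shows
    "(antimono_on {1..}
        (\<lambda>k. merit_Theta \<alpha> \<gamma> f g h (y k) (z k) (x k) (x (k - 1)) (x (k - 2))) \<and>
      (\<exists>c::real.
        (\<lambda>k. merit_Theta \<alpha> \<gamma> f g h (y k) (z k) (x k) (x (k - 1)) (x (k - 2)))
          \<longlonglongrightarrow> ereal c))
     \<and>
     ((\<lambda>k. x k - x (k - 1)) \<longlonglongrightarrow> 0 \<and>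
      (\<lambda>k. y k - y (k - 1)) \<longlonglongrightarrow> 0 \<and>
      (\<lambda>k. y k - z k) \<longlonglongrightarrow> 0 \<and>
      (\<lambda>K. Min ((\<lambda>k. norm (x k - x (k - 1))) ` {1..K})) \<in> O(\<lambda>K. 1 / sqrt (real K)) \<and>
      (\<lambda>K. Min ((\<lambda>k. norm (y k - y (k - 1))) ` {2..K})) \<in> O(\<lambda>K. 1 / sqrt (real K)) \<and>
      (\<lambda>K. Min ((\<lambda>k. norm (y k - z k)) ` {1..K})) \<in> O(\<lambda>K. 1 / sqrt (real K)))
     \<and>
     (\<forall>ys zs xs x1s x2s r.
        strict_mono r \<and> (iterate y z x \<circ> r) \<longlonglongrightarrow> (ys, zs, xs, x1s, x2s) \<longrightarrow>
        x1s = xs \<and> x2s = xs \<and> 0 \<in> limiting_subdiff (objective \<gamma> f g h) ys)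
     \<and>
     (C2 h \<and> (\<exists>M>0. \<forall>v. norm (hessian h v) \<le> M) \<and> KL_function (objective \<gamma> f g h) \<longrightarrow>
        convergent (iterate y z x))"
proof -
  have L: "0 \<le> L" and Lh_nonneg: "0 \<le> Lh"
    using g(2) h(2) by (auto dest: lipschitz_on_nonneg)
  have \<alpha>_bound: "(2 + \<gamma> * Lh) * (\<alpha> + (L / (1 - L))\<^sup>2) < 1 - L / (L + 1) - 2 * (\<gamma> * Lh)"
  proof -
    have "\<gamma> * l = L / (L + 1)" "\<gamma> * Lf1 = L / (1 - L)"
      using \<gamma>(1) by (simp_all add: l Lf1)
    then have "\<alpha> + (L / (1 - L))\<^sup>2 < (1 - L / (L + 1) - 2 * (\<gamma> * Lh)) / (2 + \<gamma> * Lh)"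
      using \<alpha>(2) by (simp add: mult.assoc flip: power_mult_distrib)
    moreover have "0 < 2 + \<gamma> * Lh"
      using \<gamma>(1) Lh_nonneg by (simp add: add_pos_nonneg)
    ultimately show ?thesis
      by (simp add: pos_less_divide_eq mult.commute)
  qed
  interpret extrapolated_dys g L f h \<alpha> \<gamma> Lh w y z x
    using g f h bounded_below(1) \<gamma>(1) \<alpha>(1) \<alpha>_bound iteration bounded_iterates
    by unfold_locales (auto simp: C2_def)
  let ?T = "\<lambda>k. merit_Theta \<alpha> \<gamma> f g h (y k) (z k) (x k) (x (k - 1)) (x (k - 2))"
  have T: "?T k = ereal (\<Theta> k)" if "1 \<le> k" for k
    using merit_Theta_Suc[of "k - 1"] that by simp
  have "antimono_on {1..} ?T"
  proof (rule monotone_onI)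
    fix j k :: nat assume jk: "j \<in> {1..}" "k \<in> {1..}" "j \<le> k"
    then have "\<Theta> k \<le> \<Theta> j"
      using decseqD[OF \<Theta>_antimono diff_le_mono[OF jk(3), of 1]] by simp
    then show "?T k \<le> ?T j"
      using jk T[of j] T[of k] by simp
  qed
  moreover have "\<exists>c::real. ?T \<longlonglongrightarrow> ereal c"
  proof -
    obtain c where "\<Theta> \<longlonglongrightarrow> c"
      using \<Theta>_converges by blast
    then have "(\<lambda>k. ereal (\<Theta> k)) \<longlonglongrightarrow> ereal c"
      by simp
    moreover have "\<forall>\<^sub>F k in sequentially. ereal (\<Theta> k) = ?T k"
      using eventually_ge_at_top[of 1] by eventually_elim (rule T[symmetric])
    ultimately have "?T \<longlonglongrightarrow> ereal c"
      by (rule Lim_transform_eventually)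
    then show ?thesis ..
  qed
  moreover have "(\<lambda>k. x k - x (k - 1)) \<longlonglongrightarrow> 0"
    using v_tendsto unfolding v_def .
  moreover have "(\<lambda>k. y k - y (k - 1)) \<longlonglongrightarrow> 0"
    using summable_dy by (rule tendsto_zero_if_square_summable)
  moreover have "(\<lambda>k. y k - z k) \<longlonglongrightarrow> 0"
    using e_tendsto unfolding e_def .
  moreover have "(\<lambda>K. Min ((\<lambda>k. norm (x k - x (k - 1))) ` {1..K})) \<in> O(\<lambda>K. 1 / sqrt (real K))"
    using summable_v unfolding v_def by (intro Min_bigo_inverse_sqrt) auto
  moreover have "(\<lambda>K. Min ((\<lambda>k. norm (y k - y (k - 1))) ` {2..K})) \<in> O(\<lambda>K. 1 / sqrt (real K))"
    using summable_dy by (intro Min_bigo_inverse_sqrt) auto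
  moreover have "(\<lambda>K. Min ((\<lambda>k. norm (y k - z k)) ` {1..K})) \<in> O(\<lambda>K. 1 / sqrt (real K))"
    using summable_e unfolding e_def by (intro Min_bigo_inverse_sqrt) auto
  moreover have "x1s = xs \<and> x2s = xs \<and> 0 \<in> limiting_subdiff (objective \<gamma> f g h) ys"
    if r: "strict_mono r" and lim: "(iterate y z x \<circ> r) \<longlonglongrightarrow> (ys, zs, xs, x1s, x2s)"
    for ys zs xs x1s x2s and r :: "nat \<Rightarrow> nat"
  proof -
    have tuple: "(\<lambda>j. iterate y z x (r j)) \<longlonglongrightarrow> (ys, zs, xs, x1s, x2s)"
      using lim by (simp add: o_def)
    have lims: "(\<lambda>j. y (r j)) \<longlonglongrightarrow> ys" "(\<lambda>j. z (r j)) \<longlonglongrightarrow> zs" "(\<lambda>j. x (r j)) \<longlonglongrightarrow> xs"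
        "(\<lambda>j. x (r j - 1)) \<longlonglongrightarrow> x1s" "(\<lambda>j. x (r j - 2)) \<longlonglongrightarrow> x2s"
      using tendsto_fst[OF tuple] tendsto_fst[OF tendsto_snd[OF tuple]]
        tendsto_fst[OF tendsto_snd[OF tendsto_snd[OF tuple]]]
        tendsto_fst[OF tendsto_snd[OF tendsto_snd[OF tendsto_snd[OF tuple]]]]
        tendsto_snd[OF tendsto_snd[OF tendsto_snd[OF tendsto_snd[OF tuple]]]]
      by (simp_all add: iterate_def)
    have r_top: "filterlim r sequentially sequentially"
      using r by (rule filterlim_subseq)
    have "(\<lambda>j. v (r j)) \<longlonglongrightarrow> xs - x1s"
      unfolding v_def by (intro tendsto_diff lims)
    from LIMSEQ_unique[OF this filterlim_compose[OF v_tendsto r_top]] have x1s: "x1s = xs"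
      by simp
    have "filterlim (\<lambda>k::nat. k - 1) sequentially sequentially"
      by (rule filterlim_minus_const_nat_at_top)
    from filterlim_compose[OF this r_top]
    have r1_top: "filterlim (\<lambda>j. r j - 1) sequentially sequentially" .
    have "(\<lambda>j. v (r j - 1)) \<longlonglongrightarrow> x1s - x2s"
      unfolding v_def diff_diff_left one_add_one by (intro tendsto_diff lims)
    from LIMSEQ_unique[OF this filterlim_compose[OF v_tendsto r1_top]] have x2s: "x2s = x1s"
      by simp
    \<comment> \<open>Dropping \<open>r 0\<close> guarantees \<open>r (Suc j) \<ge> 1\<close>, so
      every remaining term is produced by the recursion.\<close>
    define n where "n j = r (Suc j) - 1" for j
    have n: "Suc (n j) = r (Suc j)" for j
      using strict_mono_imp_increasing[OF r, of "Suc j"] by (simp add: n_def)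
    have n_top: "filterlim n sequentially sequentially"
      unfolding n_def using r1_top by (rule filterlim_sequentially_Suc[THEN iffD2])
    have Suc_lims: "(\<lambda>j. y (Suc (n j))) \<longlonglongrightarrow> ys" "(\<lambda>j. z (Suc (n j))) \<longlonglongrightarrow> zs"
        "(\<lambda>j. x (Suc (n j))) \<longlonglongrightarrow> xs"
      unfolding n using lims(1-3) by (simp_all add: filterlim_sequentially_Suc[of "\<lambda>j. _ (r j)"])
    show ?thesis
      using x1s x2s cluster_critical[OF n_top Suc_lims] cluster_y_eq_z[OF n_top Suc_lims] by simp
  qed
  moreover have "convergent (iterate y z x)" if "KL_function (objective \<gamma> f g h)"
    using that by (intro convergent_iterate convergent_x)
  ultimately show ?thesis
    by blast
qed

end
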